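(* For every integer $k>1$, $\mathrm{ATIME}[\log^k n,2]\subsetneq \mathrm{ATIME}[\log^{k+1} n,2]$. *)

theory Defs
  imports Complex_Main "HOL-Library.Landau_Symbols"
begin

text \<open>
  Alternating random-access Turing machines over binary inputs.  A machine has a read-only
  input of length \<open>n + 1\<close> whose last cell holds an endmark, a read-write address tape of
  exactly \<open>\<lceil>log n\<rceil>\<close> binary cells, and a fixed number of work tapes.  The input is accessed only
  through the cell whose number is currently written on the address tape.
\<close>

datatype in_symbol = Bit bool | Endmark

datatype dir = Left | Stay | Right

record action =
  next_state :: nat
  addr_write :: bool
  addr_dir :: dir
  work_acts :: "(nat \<times> dir) list"

record machine =
  tapes :: nat
  alphabet :: "nat set"
  blank :: nat
  ex_states :: "nat set"
  all_states :: "nat set"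
  start :: nat
  final :: "nat set"
  delta :: "nat \<Rightarrow> in_symbol \<Rightarrow> bool \<Rightarrow> nat list \<Rightarrow> action set"

definition states :: "machine \<Rightarrow> nat set" where
  "states M = ex_states M \<union> all_states M"

definition action_ok :: "machine \<Rightarrow> action \<Rightarrow> bool" where
  "action_ok M a \<longleftrightarrow> next_state a \<in> states M \<and> length (work_acts a) = tapes M \<and>
     fst ` set (work_acts a) \<subseteq> alphabet M"

definition ratm :: "machine \<Rightarrow> bool" where
  "ratm M \<longleftrightarrow> finite (states M) \<and> ex_states M \<inter> all_states M = {} \<and>
     start M \<in> states M \<and> final M \<subseteq> states M \<and> finite (alphabet M) \<and> blank M \<in> alphabet M \<and>
     (\<forall>q\<in>states M. \<forall>x b ss. length ss = tapes M \<and> set ss \<subseteq> alphabet M \<longrightarrow>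
        (\<forall>a\<in>delta M q x b ss. action_ok M a))"

record config =
  state :: nat
  addr :: "bool list"
  addr_head :: nat
  work :: "((int \<Rightarrow> nat) \<times> int) list"  \<comment> \<open>contents and head position of each two-way infinite tape\<close>

text \<open>For \<open>n = 0\<close> this is \<open>0\<close>, since \<open>log 2 0 = 0\<close>.\<close>

definition addr_length :: "nat \<Rightarrow> nat" where
  "addr_length n = nat \<lceil>log 2 (real n)\<rceil>"

definition init :: "machine \<Rightarrow> bool list \<Rightarrow> config" where
  "init M w = \<lparr>state = start M, addr = replicate (addr_length (length w)) False, addr_head = 0,
     work = replicate (tapes M) (\<lambda>_. blank M, 0)\<rparr>"

text \<open>The leftmost cell of the address tape is the most significant bit.\<close>

definition addr_value :: "bool list \<Rightarrow> nat" where
  "addr_value bs = horner_sum of_bool 2 (rev bs)"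

definition read_input :: "bool list \<Rightarrow> config \<Rightarrow> in_symbol" where
  "read_input w c =
     (let i = addr_value (addr c) in if i < length w then Bit (w ! i) else Endmark)"

text \<open>
  If the address tape has length \<open>0\<close> (inputs of length at most \<open>1\<close>), the bit read from it is
  \<open>False\<close>, and writing to it has no effect.
\<close>

definition read_addr :: "config \<Rightarrow> bool" where
  "read_addr c \<longleftrightarrow> addr_head c < length (addr c) \<and> addr c ! addr_head c"

text \<open>The head of the address tape stays in place when told to leave the tape at either end.\<close>

fun move_addr :: "nat \<Rightarrow> dir \<Rightarrow> nat \<Rightarrow> nat" where
  "move_addr l Left p = p - 1"
| "move_addr l Stay p = p"
| "move_addr l Right p = (if Suc p < l then Suc p else p)"

fun move_work :: "dir \<Rightarrow> int \<Rightarrow> int" where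
  "move_work Left p = p - 1"
| "move_work Stay p = p"
| "move_work Right p = p + 1"

definition read_work :: "config \<Rightarrow> nat list" where
  "read_work c = map (\<lambda>(f, p). f p) (work c)"

definition apply_action :: "action \<Rightarrow> config \<Rightarrow> config" where
  "apply_action a c =
     \<lparr>state = next_state a,
      addr = (addr c)[addr_head c := addr_write a],
      addr_head = move_addr (length (addr c)) (addr_dir a) (addr_head c),
      work = map2 (\<lambda>(s, d) (f, p). (f(p := s), move_work d p)) (work_acts a) (work c)\<rparr>"

definition step :: "machine \<Rightarrow> bool list \<Rightarrow> config \<Rightarrow> config \<Rightarrow> bool" where
  "step M w c c' \<longleftrightarrow>
     (\<exists>a\<in>delta M (state c) (read_input w c) (read_addr c) (read_work c). c' = apply_action a c)"

inductive accepting :: "machine \<Rightarrow> bool list \<Rightarrow> config \<Rightarrow> bool" for M w where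
  final: "state c \<in> final M \<Longrightarrow> accepting M w c"
| ex: "\<lbrakk>state c \<in> ex_states M; step M w c c'; accepting M w c'\<rbrakk> \<Longrightarrow> accepting M w c"
| all: "\<lbrakk>state c \<in> all_states M; step M w c d; \<And>c'. step M w c c' \<Longrightarrow> accepting M w c'\<rbrakk>
    \<Longrightarrow> accepting M w c"

text \<open>
  \<open>accepting_within M w t m c\<close>: there is a computation tree witnessing that \<open>c\<close> is accepting in
  which every branch makes at most \<open>t\<close> steps and consists of at most \<open>m\<close> maximal blocks of
  configurations of the same kind (existential or universal), the block of \<open>c\<close> included; that is,
  it switches between the two kinds at most \<open>m - 1\<close> times.
\<close>

definition blocks_left :: "machine \<Rightarrow> config \<Rightarrow> config \<Rightarrow> nat \<Rightarrow> nat" where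
  "blocks_left M c c' m =
     (if state c \<in> ex_states M \<longleftrightarrow> state c' \<in> ex_states M then m else m - 1)"

inductive accepting_within :: "machine \<Rightarrow> bool list \<Rightarrow> nat \<Rightarrow> nat \<Rightarrow> config \<Rightarrow> bool" for M w where
  final: "\<lbrakk>state c \<in> final M; m > 0\<rbrakk> \<Longrightarrow> accepting_within M w t m c"
| ex: "\<lbrakk>state c \<in> ex_states M; step M w c c';
      accepting_within M w t (blocks_left M c c' m) c'\<rbrakk> \<Longrightarrow> accepting_within M w (Suc t) m c"
| all: "\<lbrakk>state c \<in> all_states M; step M w c d;
      \<And>c'. step M w c c' \<Longrightarrow> accepting_within M w t (blocks_left M c c' m) c'\<rbrakk>
    \<Longrightarrow> accepting_within M w (Suc t) m c"

text \<open>
  The languages accepted by machines that start in an existential state, make \<open>O(f n)\<close> steps before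
  accepting an input of length \<open>n\<close>, and alternate so that there are at most \<open>m\<close> blocks (\<open>m = 1\<close> is
  nondeterministic time).
\<close>

definition ATIME :: "(nat \<Rightarrow> real) \<Rightarrow> nat \<Rightarrow> bool list set set" where
  "ATIME f m = {L. \<exists>M t. ratm M \<and> start M \<in> ex_states M \<and> (\<lambda>n. real (t n)) \<in> O(f) \<and>
     L = {w. accepting M w (init M w)} \<and>
     (\<forall>w\<in>L. accepting_within M w (t (length w)) m (init M w))}"

end

theory Submission
  imports Defs "HOL-Library.Countable" "HOL-Library.FuncSet"
begin

text \<open>
  Write \<open>l = \<lceil>log n\<rceil>\<close> and \<open>s = (l + 1) ^ (k + 1)\<close>.  The separating language consists of the words
  without a run of \<open>s\<close> zeros: a machine can choose a starting address universally and then scan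
  \<open>s\<close> cells.

  Now let a machine with two blocks work in time \<open>t = O(log n ^ k)\<close>, so that \<open>t\<close> is small compared
  to \<open>s\<close>.  Cut a word into \<open>m\<close> blocks of length \<open>s\<close> with separating ones, and consider the
  \<open>s ^ m\<close> words with a single \<open>1\<close> in each block.  There are only \<open>2 ^ O(t)\<close> existential guesses, so
  for \<open>m\<close> a large multiple of \<open>t\<close> some guess is good for a set \<open>X\<close> of more than \<open>(t + 1) ^ m\<close> of
  these words.  Such a set has a limit: a word with an empty block that agrees with some member of
  \<open>X\<close> on any \<open>t + 1\<close> given cells.  With the same guess, no universal branch can tell it from all
  members of \<open>X\<close>, so it is accepted although it has a run of \<open>s\<close> zeros.
\<close>

subsection \<open>Limits of accepted words\<close>

definition cell :: "bool list \<Rightarrow> nat \<Rightarrow> in_symbol" where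
  "cell w i = (if i < length w then Bit (w ! i) else Endmark)"

lemma read_input_cell: "read_input w c = cell w (addr_value (addr c))"
  by (simp add: read_input_def cell_def Let_def)

lemma step_cong:
  assumes "cell x (addr_value (addr c)) = cell y (addr_value (addr c))"
  shows "step M x c c' \<longleftrightarrow> step M y c c'"
  using assms by (simp add: step_def read_input_cell)

lemma accepting_within_mono:
  assumes "accepting_within M w t m c" "t \<le> t'"
  shows "accepting_within M w t' m c"
  using assms
proof (induction arbitrary: t' rule: accepting_within.induct)
  case (final c m t)
  then show ?case by (simp add: accepting_within.final)
next
  case (ex c c' t m)
  then obtain t'' where "t' = Suc t''" "t \<le> t''" by (metis Suc_le_D Suc_le_mono)
  with ex show ?case by (auto intro: accepting_within.ex)
next
  case (all c d t m)
  then obtain t'' where "t' = Suc t''" "t \<le> t''" by (metis Suc_le_D Suc_le_mono)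
  with all show ?case by (auto intro: accepting_within.all)
qed

lemma accepting_within_blocks_pos:
  assumes "accepting_within M w t m c"
  shows "m > 0"
  using assms
proof induction
  case (all c d t m)
  from all.IH[OF all.hyps(2)] show ?case by (auto simp: blocks_left_def split: if_splits)
qed (auto simp: blocks_left_def split: if_splits)

text \<open>The finite limits of circuit lower bounds: no inspection of at most \<open>r\<close>
  cells separates \<open>y\<close> from all of \<open>X\<close>. The witness \<open>x\<close> may
  depend on the cells inspected.\<close>

definition limit :: "bool list set \<Rightarrow> nat \<Rightarrow> bool list \<Rightarrow> bool" where
  "limit X r y \<longleftrightarrow> (\<forall>S. finite S \<and> card S \<le> r \<longrightarrow> (\<exists>x\<in>X. \<forall>q\<in>S. cell x q = cell y q))"

text \<open>One unit of \<open>r\<close> pays for the cell \<open>q\<close>: a witness for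
  \<open>insert q S\<close> agrees with \<open>y\<close> at \<open>q\<close> as well.\<close>

lemma limit_restrict:
  assumes "limit X (Suc r) y"
  shows "limit {x \<in> X. cell x q = cell y q} r y"
  unfolding limit_def
proof (intro allI impI)
  fix S :: "nat set"
  assume S: "finite S \<and> card S \<le> r"
  then have "finite (insert q S) \<and> card (insert q S) \<le> Suc r"
    by (auto simp: card_insert_if)
  then obtain x where "x \<in> X" "\<forall>q\<in>insert q S. cell x q = cell y q"
    using assms unfolding limit_def by meson
  then show "\<exists>x\<in>{x \<in> X. cell x q = cell y q}. \<forall>q\<in>S. cell x q = cell y q"
    by (intro bexI[of _ x]) auto
qed

lemma limit_nonempty:
  assumes "limit X r y"
  shows "X \<noteq> {}"
  using assms[unfolded limit_def, THEN spec, of "{}"] by auto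

lemma limit_agree:
  assumes "limit X (Suc r) y"
  obtains x where "x \<in> X" "cell x q = cell y q"
  using limit_nonempty[OF limit_restrict[OF assms]] by blast

text \<open>
  A branch of length \<open>t\<close> looks at \<open>t\<close> cells, and on these \<open>y\<close> cannot be told from some
  member of \<open>X\<close>.
\<close>

lemma accepting_limit_universal:
  assumes "limit X (Suc t) y" "state c \<in> final M \<or> state c \<notin> ex_states M"
    and "\<And>x. x \<in> X \<Longrightarrow> accepting_within M x t 1 c"
  shows "accepting M y c"
  using assms
proof (induction t arbitrary: c X)
  case 0
  obtain x where "x \<in> X" using limit_nonempty[OF "0.prems"(1)] by blast
  from "0.prems"(3)[OF this] have "state c \<in> final M"
    by cases auto
  then show ?case by (rule accepting.final)
next
  case (Suc t)
  show ?case
  proof (cases "state c \<in> final M")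
    case True
    then show ?thesis by (rule accepting.final)
  next
    case False
    let ?q = "addr_value (addr c)"
    let ?X = "{x \<in> X. cell x ?q = cell y ?q}"
    have lim: "limit ?X (Suc t) y" by (rule limit_restrict[OF Suc.prems(1)])
    have succ: "state c \<in> all_states M \<and> (\<exists>d. step M x c d) \<and>
        (\<forall>c'. step M x c c' \<longrightarrow> accepting_within M x t (blocks_left M c c' 1) c')" if "x \<in> X" for x
      using Suc.prems(3)[OF that] False Suc.prems(2)
      by cases auto
    have same: "step M x c c' \<longleftrightarrow> step M y c c'" if "x \<in> ?X" for x c'
      using that by (intro step_cong) auto
    obtain x where x: "x \<in> ?X" using limit_nonempty[OF lim] by blast
    then obtain d where d: "step M y c d" using succ[of x] same[OF x] by auto
    show ?thesis
    proof (rule accepting.all[OF _ d])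
      show "state c \<in> all_states M" using succ[of x] x by auto
      fix c' assume c': "step M y c c'"
      have *: "accepting_within M x t (blocks_left M c c' 1) c'" if "x \<in> ?X" for x
        using succ[of x] same[OF that] that c' by auto
      \<comment> \<open>With one block left, a switch to an existential state would leave zero
        blocks, for which no computation tree exists.\<close>
      have "blocks_left M c c' 1 > 0" using *[OF x] by (rule accepting_within_blocks_pos)
      then have bl: "blocks_left M c c' 1 = 1" "state c' \<notin> ex_states M"
        using Suc.prems(2) False by (auto simp: blocks_left_def split: if_splits)
      show "accepting M y c'"
        using * bl by (intro Suc.IH[OF lim]) auto
    qed
  qed
qed

section \<open>Existential blocks as lists of actions\<close>

fun follows :: "machine \<Rightarrow> bool list \<Rightarrow> config \<Rightarrow> action list \<Rightarrow> bool" where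
  "follows M w c [] \<longleftrightarrow> True"
| "follows M w c (a # as) \<longleftrightarrow> state c \<in> ex_states M \<and>
     a \<in> delta M (state c) (read_input w c) (read_addr c) (read_work c) \<and>
     follows M w (apply_action a c) as"

text \<open>Two blocks allow one switch, so the tree contains a path of existential configurations
  up to a final or a non-existential one, where one block is left. The full time \<open>t\<close> is
  kept for the rest, by monotonicity. The premise \<open>m = 2\<close> is an equation so that the
  induction sees a variable.\<close>

lemma accepting_within_existential_prefix:
  assumes "accepting_within M w t m c" "m = 2" "state c \<in> ex_states M"
    and "ex_states M \<inter> all_states M = {}"
  shows "\<exists>as. length as \<le> t \<and> follows M w c as \<and> accepting_within M w t 1 (fold apply_action as c) \<and>
     (state (fold apply_action as c) \<in> final M \<or> state (fold apply_action as c) \<notin> ex_states M)"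
  using assms
proof (induction rule: accepting_within.induct)
  case (final c m t)
  then show ?case by (intro exI[of _ "[]"]) (auto intro: accepting_within.final)
next
  case (ex c c' t m)
  from ex.hyps(2) obtain a where
    a: "a \<in> delta M (state c) (read_input w c) (read_addr c) (read_work c)" "c' = apply_action a c"
    by (auto simp: step_def)
  show ?case
  proof (cases "state c' \<in> ex_states M")
    case True
    then have "blocks_left M c c' m = 2" using ex by (auto simp: blocks_left_def)
    with ex.IH True ex.prems(3) obtain as where "length as \<le> t" "follows M w c' as"
      "accepting_within M w t 1 (fold apply_action as c')"
      "state (fold apply_action as c') \<in> final M \<or> state (fold apply_action as c') \<notin> ex_states M"
      by auto
    then show ?thesis using a ex.hyps(1)
      by (intro exI[of _ "a # as"]) (auto intro: accepting_within_mono)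
  next
    case False
    then have "blocks_left M c c' m = 1" using ex by (auto simp: blocks_left_def)
    then show ?thesis using a ex.hyps False
      by (intro exI[of _ "[a]"]) (auto intro: accepting_within_mono)
  qed
next
  case (all c d t m)
  then show ?case by auto
qed

text \<open>A list of actions determines all configurations on its path, whatever the input. Hence
  \<open>X\<close> need not shrink here: each step of \<open>y\<close> is justified by some member
  of \<open>X\<close> that agrees on the one cell read at that moment, possibly a different member
  each time.\<close>

lemma accepting_limit_existential:
  assumes "limit X (Suc r) y" "\<And>x. x \<in> X \<Longrightarrow> follows M x c as"
    and "accepting M y (fold apply_action as c)"
  shows "accepting M y c"
  using assms
proof (induction as arbitrary: c)
  case Nil
  then show ?case by simp
next
  case (Cons a as)
  obtain x where x: "x \<in> X" "cell x (addr_value (addr c)) = cell y (addr_value (addr c))"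
    using limit_agree[OF Cons.prems(1)] by blast
  have ex: "state c \<in> ex_states M" and "step M x c (apply_action a c)"
    using Cons.prems(2)[OF x(1)] by (auto simp: step_def)
  then have "step M y c (apply_action a c)"
    using step_cong[OF x(2)] by blast
  moreover have "accepting M y (apply_action a c)"
  proof (rule Cons.IH[OF Cons.prems(1)])
    show "follows M x (apply_action a c) as" if "x \<in> X" for x
      using Cons.prems(2)[OF that] by simp
  qed (use Cons.prems(3) in simp)
  ultimately show ?case by (rule accepting.ex[OF ex])
qed

section \<open>Counting the possible guesses\<close>

definition well_formed :: "machine \<Rightarrow> config \<Rightarrow> bool" where
  "well_formed M c \<longleftrightarrow> state c \<in> states M \<and> length (work c) = tapes M \<and>
     (\<forall>(f, p)\<in>set (work c). range f \<subseteq> alphabet M)"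

lemma well_formed_init: "ratm M \<Longrightarrow> well_formed M (init M w)"
  by (auto simp: well_formed_def init_def ratm_def)

text \<open>\<open>ratm\<close> restricts \<open>delta\<close> only on legal states and symbols, so
  bounding the number of usable actions takes the invariant that configurations contain nothing
  else.\<close>

lemma well_formed_action_ok:
  assumes "ratm M" "well_formed M c"
    and "a \<in> delta M (state c) (read_input w c) (read_addr c) (read_work c)"
  shows "action_ok M a"
proof -
  have "length (read_work c) = tapes M"
    using assms(2) by (simp add: well_formed_def read_work_def)
  moreover have "set (read_work c) \<subseteq> alphabet M"
  proof
    fix s assume "s \<in> set (read_work c)"
    then obtain f p where "(f, p) \<in> set (work c)" "s = f p" by (auto simp: read_work_def)
    then show "s \<in> alphabet M" using assms(2) unfolding well_formed_def by blast
  qed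
  moreover have "state c \<in> states M" using assms(2) by (simp add: well_formed_def)
  ultimately show ?thesis using assms(1,3) unfolding ratm_def by meson
qed

lemma well_formed_apply_action:
  assumes "well_formed M c" "action_ok M a"
  shows "well_formed M (apply_action a c)"
proof -
  have "range f \<subseteq> alphabet M" if fp: "(f, p) \<in> set (work (apply_action a c))" for f p
  proof -
    obtain s d g q where z: "((s, d), (g, q)) \<in> set (zip (work_acts a) (work c))" "f = g(q := s)"
      using fp by (auto simp: apply_action_def)
    then have "s \<in> fst ` set (work_acts a)" "(g, q) \<in> set (work c)"
      by (force dest: set_zip_leftD set_zip_rightD)+
    then have "s \<in> alphabet M" "range g \<subseteq> alphabet M"
      using assms unfolding well_formed_def action_ok_def by blast+
    then show ?thesis using z(2) by auto
  qed
  moreover have "state (apply_action a c) \<in> states M" "length (work (apply_action a c)) = tapes M"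
    using assms by (auto simp: well_formed_def action_ok_def apply_action_def)
  ultimately show ?thesis unfolding well_formed_def by blast
qed

lemma follows_action_ok:
  assumes "ratm M" "well_formed M c" "follows M w c as"
  shows "set as \<subseteq> {a. action_ok M a}"
  using assms(2,3)
proof (induction as arbitrary: c)
  case (Cons a as)
  have "action_ok M a"
    using Cons.prems by (intro well_formed_action_ok[OF assms(1)]) auto
  with Cons.IH[OF well_formed_apply_action] Cons.prems show ?case by auto
qed simp

lemma finite_action_ok:
  assumes "ratm M"
  shows "finite {a. action_ok M a}"
proof -
  have fd: "finite (UNIV :: dir set)"
    by (rule finite_subset[of _ "{Left, Stay, Right}"]) (use dir.exhaust in auto)
  let ?W = "{xs. set xs \<subseteq> alphabet M \<times> (UNIV :: dir set) \<and> length xs = tapes M}"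
  let ?f = "\<lambda>(q, b, d, xs). \<lparr>next_state = q, addr_write = b, addr_dir = d, work_acts = xs\<rparr>"
  have "{a. action_ok M a} \<subseteq> ?f ` (states M \<times> UNIV \<times> UNIV \<times> ?W)"
  proof
    fix a assume "a \<in> {a. action_ok M a}"
    then have "(next_state a, addr_write a, addr_dir a, work_acts a) \<in> states M \<times> UNIV \<times> UNIV \<times> ?W"
      by (force simp: action_ok_def)
    moreover have "a = ?f (next_state a, addr_write a, addr_dir a, work_acts a)" by simp
    ultimately show "a \<in> ?f ` (states M \<times> UNIV \<times> UNIV \<times> ?W)" by blast
  qed
  moreover have "finite ?W" "finite (states M)"
    using assms fd by (auto simp: ratm_def intro!: finite_lists_length_eq)
  ultimately show ?thesis using fd by (meson finite_SigmaI finite_code finite_imageI finite_subset)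
qed

lemma card_lists_length_le_bound:
  assumes "finite A"
  shows "card {xs. set xs \<subseteq> A \<and> length xs \<le> n} \<le> (card A + 1) ^ n"
proof -
  have "(\<Sum>i\<le>n. card A ^ i) \<le> (card A + 1) ^ n"
  proof (induction n)
    case (Suc n)
    have "card A ^ Suc n \<le> card A * (card A + 1) ^ n" by (simp add: power_mono)
    with Suc have "(\<Sum>i\<le>Suc n. card A ^ i) \<le> (card A + 1) ^ n + card A * (card A + 1) ^ n"
      by (simp only: sum.atMost_Suc add_mono)
    then show ?case by (simp add: algebra_simps)
  qed simp
  then show ?thesis using assms by (simp add: card_lists_length_le)
qed

text \<open>
  The limit argument of Hastad, Jukna and Pudlak.  If \<open>J = I\<close> fails, some small \<open>S\<close> meets the
  graph of every \<open>u \<in> X\<close>, so a popular pair \<open>(i, l) \<in> S\<close> keeps at least a fraction \<open>1 / r\<close> of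
  \<open>X\<close>; fix \<open>u i = l\<close> and continue without \<open>i\<close>.
\<close>

lemma exists_limit_function:
  fixes X :: "('i \<Rightarrow> 'l) set"
  assumes "finite I" "finite X" "\<And>u v. u \<in> X \<Longrightarrow> v \<in> X \<Longrightarrow> (\<forall>i\<in>I. u i = v i) \<Longrightarrow> u = v"
    and "card X > r ^ card I"
  shows "\<exists>J g. J \<subseteq> I \<and> J \<noteq> {} \<and> (\<forall>S. finite S \<and> card S \<le> r \<longrightarrow>
     (\<exists>u\<in>X. (\<forall>i\<in>I - J. u i = g i) \<and> (\<forall>i\<in>J. (i, u i) \<notin> S)))"
  using assms
proof (induction "card I" arbitrary: I X)
  case 0
  \<comment> \<open>Since \<open>r ^ 0 = 1\<close>, \<open>X\<close> would have two members; with no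
    coordinates left they coincide.\<close>
  then have "\<forall>u\<in>X. \<forall>v\<in>X. u = v" by auto
  then have "card X \<le> 1" using \<open>finite X\<close> by (simp add: card_le_Suc0_iff_eq)
  with 0 show ?case by simp
next
  case (Suc m)
  show ?case
  proof (cases "\<forall>S. finite S \<and> card S \<le> r \<longrightarrow> (\<exists>u\<in>X. \<forall>i\<in>I. (i, u i) \<notin> S)")
    case True
    moreover have "I \<noteq> {}" using Suc.hyps(2) by auto
    ultimately show ?thesis by (intro exI[of _ I] exI[of _ undefined]) auto
  next
    case False
    then obtain S where S: "finite S" "card S \<le> r" "\<forall>u\<in>X. \<exists>i\<in>I. (i, u i) \<in> S" by metis
    define P where "P = S \<inter> (I \<times> UNIV)"
    define Y where "Y = (\<lambda>(i, l). {u \<in> X. u i = l})"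
    have P: "finite P" "card P \<le> r"
      using S card_mono[of S P] by (auto simp: P_def)
    have "X \<subseteq> (\<Union>z\<in>P. Y z)" using S(3) by (fastforce simp: P_def Y_def)
    then have "card X \<le> card (\<Union>z\<in>P. Y z)"
      using P Suc.prems(2) by (intro card_mono) (auto simp: Y_def)
    also have "\<dots> \<le> (\<Sum>z\<in>P. card (Y z))" using P by (intro card_UN_le)
    finally have le: "card X \<le> (\<Sum>z\<in>P. card (Y z))" .
    have "\<exists>z\<in>P. card (Y z) > r ^ m"
    proof (rule ccontr)
      assume "\<not> ?thesis"
      then have "(\<Sum>z\<in>P. card (Y z)) \<le> (\<Sum>z\<in>P. r ^ m)" by (intro sum_mono) auto
      also have "\<dots> \<le> r * r ^ m" using P(2) by simp
      finally show False using le Suc.prems(4) unfolding Suc.hyps(2)[symmetric] by simp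
    qed
    then obtain i l where il: "i \<in> I" "card {u \<in> X. u i = l} > r ^ m"
      by (auto simp: P_def Y_def)
    have m: "m = card (I - {i})" using Suc.hyps(2) il(1) Suc.prems(1) by simp
    have "\<exists>J g. J \<subseteq> I - {i} \<and> J \<noteq> {} \<and> (\<forall>S. finite S \<and> card S \<le> r \<longrightarrow>
       (\<exists>u\<in>{u \<in> X. u i = l}. (\<forall>j\<in>I - {i} - J. u j = g j) \<and> (\<forall>j\<in>J. (j, u j) \<notin> S)))"
    proof (rule Suc.hyps(1)[OF m])
      show "u = v" if "u \<in> {u \<in> X. u i = l}" "v \<in> {u \<in> X. u i = l}" "\<forall>j\<in>I - {i}. u j = v j" for u v
        using that Suc.prems(3)[of u v] by fastforce
    qed (use Suc.prems il m in auto)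
    then obtain J g where Jg: "J \<subseteq> I - {i}" "J \<noteq> {}" "\<forall>S. finite S \<and> card S \<le> r \<longrightarrow>
       (\<exists>u\<in>{u \<in> X. u i = l}. (\<forall>j\<in>I - {i} - J. u j = g j) \<and> (\<forall>j\<in>J. (j, u j) \<notin> S))"
      by (elim exE conjE) (rule that)
    show ?thesis
    proof (intro exI[of _ J] exI[of _ "g(i := l)"] conjI allI impI)
      fix S :: "('i \<times> 'l) set" assume S: "finite S \<and> card S \<le> r"
      have "\<exists>u\<in>{u \<in> X. u i = l}. (\<forall>j\<in>I - {i} - J. u j = g j) \<and> (\<forall>j\<in>J. (j, u j) \<notin> S)"
        using Jg(3)[THEN spec, of S] S by (rule mp)
      then obtain u where "u \<in> X" "u i = l" "\<forall>j\<in>I - {i} - J. u j = g j" "\<forall>j\<in>J. (j, u j) \<notin> S"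
        by blast
      then show "\<exists>u\<in>X. (\<forall>j\<in>I - J. u j = (g(i := l)) j) \<and> (\<forall>j\<in>J. (j, u j) \<notin> S)"
        by (intro bexI[of _ u]) auto
    qed (use Jg(1,2) in auto)
  qed
qed

section \<open>Fooling a machine with two blocks\<close>

lemma pigeonhole_fiber:
  assumes "finite X" "finite Y" "f ` X \<subseteq> Y" "card X > card Y * b"
  shows "\<exists>y\<in>Y. card {x \<in> X. f x = y} > b"
proof (rule ccontr)
  assume "\<not> ?thesis"
  then have "(\<Sum>y\<in>Y. card {x \<in> X. f x = y}) \<le> (\<Sum>y\<in>Y. b)" by (intro sum_mono) auto
  moreover have "card X = (\<Sum>y\<in>Y. card {x \<in> X. f x = y})"
    using sum.group[OF assms(1-3), of "\<lambda>_. 1::nat"] by simp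
  ultimately show False using assms(4) by simp
qed

text \<open>
  Blocks of \<open>s\<close> cells, each followed by a separating \<open>1\<close>.  The only further \<open>1\<close> in block \<open>i < m\<close>
  is at \<open>u i\<close>; the value \<open>u i = s\<close> encodes an empty block.
\<close>

definition block_word :: "nat \<Rightarrow> nat \<Rightarrow> nat \<Rightarrow> (nat \<Rightarrow> nat) \<Rightarrow> bool list" where
  "block_word n m s u = map (\<lambda>q. q div Suc s < m \<longrightarrow> q mod Suc s \<in> {s, u (q div Suc s)}) [0..<n]"

lemma length_block_word [simp]: "length (block_word n m s u) = n"
  by (simp add: block_word_def)

text \<open>Empty all blocks in \<open>J\<close>. Inside such a block the words of \<open>u\<close>
  and \<open>v\<close> differ only at offset \<open>u i\<close>, so cells that avoid every pair
  \<open>(i, u i)\<close> cannot tell them apart; the other blocks agree by the choice of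
  \<open>g\<close>. As \<open>J\<close> is nonempty, some block is empty.\<close>

lemma limit_block_words:
  assumes X: "finite X" "X \<subseteq> {..<m} \<rightarrow>\<^sub>E {..<s}" "card X > r ^ m"
  shows "\<exists>u i. i < m \<and> u i = s \<and> limit (block_word n m s ` X) r (block_word n m s u)"
proof -
  have "\<exists>J g. J \<subseteq> {..<m} \<and> J \<noteq> {} \<and> (\<forall>S. finite S \<and> card S \<le> r \<longrightarrow>
     (\<exists>u\<in>X. (\<forall>i\<in>{..<m} - J. u i = g i) \<and> (\<forall>i\<in>J. (i, u i) \<notin> S)))"
  proof (rule exists_limit_function)
    fix u v assume "u \<in> X" "v \<in> X" "\<forall>i\<in>{..<m}. u i = v i"
    with X(2) show "u = v" by (intro PiE_ext[of u "{..<m}" "\<lambda>_. {..<s}" v]) auto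
  qed (use X in auto)
  then obtain J g where Jg: "J \<subseteq> {..<m}" "J \<noteq> {}" "\<And>S. finite S \<Longrightarrow> card S \<le> r \<Longrightarrow>
     \<exists>u\<in>X. (\<forall>i\<in>{..<m} - J. u i = g i) \<and> (\<forall>i\<in>J. (i, u i) \<notin> S)" by metis
  obtain i where i: "i \<in> J" using Jg(2) by blast
  define v where "v = (\<lambda>i. if i \<in> J then s else g i)"
  have "limit (block_word n m s ` X) r (block_word n m s v)"
    unfolding limit_def
  proof (intro allI impI)
    fix S :: "nat set" assume S: "finite S \<and> card S \<le> r"
    let ?S = "(\<lambda>q. (q div Suc s, q mod Suc s)) ` S"
    have "finite ?S" "card ?S \<le> r" using S card_image_le[of S "\<lambda>q. (q div Suc s, q mod Suc s)"] by auto
    then obtain u where u: "u \<in> X" "\<forall>i\<in>{..<m} - J. u i = g i" "\<forall>i\<in>J. (i, u i) \<notin> ?S"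
      using Jg(3) by blast
    have "cell (block_word n m s u) q = cell (block_word n m s v) q" if "q \<in> S" for q
    proof (cases "q < n \<and> q div Suc s \<in> J")
      case True
      then have "u (q div Suc s) \<noteq> q mod Suc s" using u(3) that by (metis (no_types, lifting) image_eqI)
      then show ?thesis using True by (auto simp: cell_def block_word_def v_def)
    next
      case False
      then show ?thesis using u(2) by (auto simp: cell_def block_word_def v_def)
    qed
    then show "\<exists>x\<in>block_word n m s ` X. \<forall>q\<in>S. cell x q = cell (block_word n m s v) q"
      using u(1) by blast
  qed
  moreover have "v i = s" "i < m" using i Jg(1) by (auto simp: v_def)
  ultimately show ?thesis by blast
qed

text \<open>In \<open>count\<close>, \<open>s ^ m\<close> is the number of placements of a single
  one in every block, the first factor bounds the number of guesses, and \<open>(t + 1) ^ m\<close>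
  is what the placements sharing a guess must exceed to have a limit.\<close>

lemma sigma2_fooled:
  assumes M: "ratm M" "start M \<in> ex_states M"
    and within: "\<And>u. u \<in> {..<m} \<rightarrow>\<^sub>E {..<s} \<Longrightarrow>
        accepting_within M (block_word n m s u) t 2 (init M (block_word n m s u))"
    and count: "(card {a. action_ok M a} + 1) ^ t * (t + 1) ^ m < s ^ m"
  shows "\<exists>u i. i < m \<and> u i = s \<and> accepting M (block_word n m s u) (init M (block_word n m s u))"
proof -
  let ?U = "{..<m} \<rightarrow>\<^sub>E {..<s}" and ?A = "{a. action_ok M a}"
  let ?x = "block_word n m s"
  define c0 where "c0 = init M (?x (\<lambda>_. 0))"
  \<comment> \<open>The initial configuration depends only on the length of the input, so all these
    words start alike.\<close>
  have c0: "init M (?x u) = c0" for u by (simp add: c0_def init_def)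
  define ok where "ok = (\<lambda>u as. length as \<le> t \<and> follows M (?x u) c0 as \<and>
     accepting_within M (?x u) t 1 (fold apply_action as c0) \<and>
     (state (fold apply_action as c0) \<in> final M \<or> state (fold apply_action as c0) \<notin> ex_states M))"
  have "\<exists>as. ok u as" if "u \<in> ?U" for u
    unfolding ok_def
    using within[OF that] M
    by (intro accepting_within_existential_prefix) (auto simp: c0 c0_def init_def ratm_def)
  then obtain guess where guess: "\<And>u. u \<in> ?U \<Longrightarrow> ok u (guess u)" by metis
  let ?Y = "{as. set as \<subseteq> ?A \<and> length as \<le> t}"
  have finA: "finite ?A" by (rule finite_action_ok[OF M(1)])
  have finY: "finite ?Y" using finite_lists_length_le[OF finA] .
  have "well_formed M c0" unfolding c0_def by (rule well_formed_init[OF M(1)])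
  then have sub: "guess ` ?U \<subseteq> ?Y"
    using guess follows_action_ok[OF M(1)] by (fastforce simp: ok_def)
  have finU: "finite ?U" by (auto intro: finite_PiE)
  have "card ?Y * (t + 1) ^ m \<le> (card ?A + 1) ^ t * (t + 1) ^ m"
    using card_lists_length_le_bound[OF finA, of t] by (intro mult_right_mono) auto
  also have "\<dots> < s ^ m" by (rule count)
  also have "s ^ m = card ?U" by (simp add: card_PiE)
  finally obtain as where as: "card {u \<in> ?U. guess u = as} > (t + 1) ^ m"
    using pigeonhole_fiber[OF finU finY sub] by blast
  define X where "X = {u \<in> ?U. guess u = as}"
  have "finite X" "X \<subseteq> ?U" using finU by (auto simp: X_def)
  \<comment> \<open>\<open>Suc t\<close> covers the \<open>t\<close> cells read on a universal
    branch and is at least 1, as the existential steps require.\<close>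
  then obtain v i where vi: "i < m" "v i = s" "limit (?x ` X) (Suc t) (?x v)"
    using limit_block_words[of X m s "Suc t" n] as by (auto simp: X_def)
  have ok: "ok u as" if "u \<in> X" for u using that guess by (auto simp: X_def)
  obtain u0 where "u0 \<in> X" using limit_nonempty[OF vi(3)] by blast
  have "accepting M (?x v) (fold apply_action as c0)"
  proof (rule accepting_limit_universal[OF vi(3)])
    show "state (fold apply_action as c0) \<in> final M \<or> state (fold apply_action as c0) \<notin> ex_states M"
      using ok[OF \<open>u0 \<in> X\<close>] by (simp add: ok_def)
  qed (use ok in \<open>auto simp: ok_def\<close>)
  then have "accepting M (?x v) c0"
    by (rule accepting_limit_existential[OF vi(3), rotated]) (use ok in \<open>auto simp: ok_def\<close>)
  then show ?thesis using vi(1,2) by (intro exI[of _ v] exI[of _ i]) (simp add: c0)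
qed

subsection \<open>A machine looking for runs of zeros\<close>

datatype mode = Measure | Fill | Return | Test | Carry | Accept

instance mode :: countable
  by countable_datatype

definition code :: "mode \<Rightarrow> bool list \<Rightarrow> nat" where
  "code md ds = to_nat (md, ds)"

lemma code_eq_iff [simp]: "code md ds = code md' ds' \<longleftrightarrow> md = md' \<and> ds = ds'"
  by (simp add: code_def)

lemma from_nat_code [simp]: "from_nat (code md ds) = (md, ds)"
  by (simp add: code_def)

definition heading :: "bool \<Rightarrow> dir" where
  "heading d = (if d then Right else Left)"

definition keep :: "nat list \<Rightarrow> (nat \<times> dir) list" where
  "keep = map (\<lambda>s. (s, Stay))"

text \<open>\<open>ds\<close> holds the directions of the clock heads. A blank marks a full digit:
  its head reverses and the carry passes to the next tape, while the first digit that is not full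
  absorbs it. \<open>tick\<close> makes the matching head moves.\<close>

fun turn :: "bool list \<Rightarrow> nat list \<Rightarrow> bool list" where
  "turn (d # ds) (s # ss) = (if s = 0 then (\<not> d) # turn ds ss else d # ds)"
| "turn ds ss = ds"

fun tick :: "bool list \<Rightarrow> nat list \<Rightarrow> (nat \<times> dir) list" where
  "tick (d # ds) (s # ss) = (if s = 0 then (s, heading (\<not> d)) # tick ds ss else (s, heading d) # keep ss)"
| "tick ds ss = keep ss"

text \<open>
  \<open>Measure\<close> overwrites the initial zeros of the address tape by ones; since the head cannot leave the
  tape, it reads a \<open>1\<close> once it has been at the last cell.  By then each work tape carries as many
  marks as the address tape has cells.  Work tape \<open>0\<close> follows the address head and reads a blank
  beyond the ends of the address tape, the others are the clock: \<open>Test\<close> advances it and gives up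
  when it has run out.  \<open>Carry\<close> and \<open>Return\<close> increment the address.
\<close>

fun moves :: "mode \<Rightarrow> bool list \<Rightarrow> in_symbol \<Rightarrow> bool \<Rightarrow> nat \<Rightarrow> nat list \<Rightarrow> action set" where
  "moves Measure ds x b s ss =
     {if b then \<lparr>next_state = code Fill ds, addr_write = b, addr_dir = Stay, work_acts = map (\<lambda>s. (s, Left)) (s # ss)\<rparr>
      else \<lparr>next_state = code Measure ds, addr_write = True, addr_dir = Right, work_acts = map (\<lambda>_. (1, Right)) (s # ss)\<rparr>}"
| "moves Fill ds x b s ss =
     (if s = 0 then {\<lparr>next_state = code Return ds, addr_write = b, addr_dir = Stay, work_acts = (s, Right) # keep ss\<rparr>}
      else {\<lparr>next_state = code Fill ds, addr_write = b', addr_dir = Left, work_acts = (s, Left) # keep ss\<rparr> |b'. True})"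
| "moves Return ds x b s ss =
     {if s = 0 then \<lparr>next_state = code Test ds, addr_write = b, addr_dir = Stay, work_acts = (s, Left) # keep ss\<rparr>
      else \<lparr>next_state = code Return ds, addr_write = b, addr_dir = Right, work_acts = (s, Right) # keep ss\<rparr>}"
| "moves Test ds x b s ss =
     (if x \<noteq> Bit False then {\<lparr>next_state = code Accept ds, addr_write = b, addr_dir = Stay, work_acts = keep (s # ss)\<rparr>}
      else if \<forall>s\<in>set ss. s = 0 then {}
      else {\<lparr>next_state = code Carry (turn ds ss), addr_write = b, addr_dir = Stay, work_acts = (s, Stay) # tick ds ss\<rparr>})"
| "moves Carry ds x b s ss =
     {if s = 0 then \<lparr>next_state = code Accept ds, addr_write = b, addr_dir = Stay, work_acts = keep (s # ss)\<rparr>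
      else if b then \<lparr>next_state = code Carry ds, addr_write = False, addr_dir = Left, work_acts = (s, Left) # keep ss\<rparr>
      else \<lparr>next_state = code Return ds, addr_write = True, addr_dir = Stay, work_acts = keep (s # ss)\<rparr>}"
| "moves Accept ds x b s ss = {}"

text \<open>Only \<open>Measure\<close> is existential, and it is deterministic; all other phases
  count as universal. This gives the two blocks, while real branching happens only in
  \<open>Fill\<close>.\<close>

definition run_machine :: "nat \<Rightarrow> machine" where
  "run_machine K = \<lparr>tapes = Suc K, alphabet = {0, 1}, blank = 0,
     ex_states = {code Measure (replicate K False)},
     all_states = {code md ds |md ds. md \<noteq> Measure \<and> length ds = K},
     start = code Measure (replicate K False),
     final = {code Accept ds |ds. length ds = K},
     delta = (\<lambda>q x b ss. case from_nat q of (md, ds) \<Rightarrow> moves md ds x b (hd ss) (tl ss))\<rparr>"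

lemma length_turn [simp]: "length (turn ds ss) = length ds"
  by (induction ds ss rule: turn.induct) auto

lemma length_tick [simp]: "length (tick ds ss) = length ss"
  by (induction ds ss rule: tick.induct) (auto simp: keep_def)

lemma fst_set_tick: "fst ` set (tick ds ss) \<subseteq> set ss"
  by (induction ds ss rule: tick.induct) (auto simp: keep_def)

lemma moves_ok:
  assumes "a \<in> moves md ds x b s ss" "length ds = K" "length ss = K" "set (s # ss) \<subseteq> {0, 1}"
    "md = Measure \<longrightarrow> ds = replicate K False"
  shows "action_ok (run_machine K) a"
  using assms fst_set_tick[of ds ss]
  by (cases md)
    (auto simp: action_ok_def run_machine_def states_def keep_def split: if_splits)

lemma ratm_run_machine: "ratm (run_machine K)"
proof -
  have fm: "finite (UNIV :: mode set)"
    by (rule finite_subset[of _ "{Measure, Fill, Return, Test, Carry, Accept}"]) (use mode.exhaust in auto)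
  have fb: "finite {ds :: bool list. length ds = K}"
    using finite_lists_length_eq[of "UNIV :: bool set" K] by simp
  have st: "states (run_machine K) \<subseteq> (\<lambda>(md, ds). code md ds) ` (UNIV \<times> {ds. length ds = K})"
    by (auto simp: states_def run_machine_def)
  have "action_ok (run_machine K) a"
    if q: "q \<in> states (run_machine K)" and ss: "length ss = Suc K" "set ss \<subseteq> {0, 1}"
      and a: "a \<in> delta (run_machine K) q x b ss" for q x b ss a
  proof -
    obtain md ds where md: "q = code md ds" "length ds = K" "md = Measure \<longrightarrow> ds = replicate K False"
      using q by (auto simp: states_def run_machine_def)
    obtain s ss' where s: "ss = s # ss'" using ss(1) by (cases ss) auto
    have "a \<in> moves md ds x b s ss'" using a md(1) s by (simp add: run_machine_def)
    then show ?thesis using moves_ok[of a md ds x b s ss' K] md ss s by simp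
  qed
  moreover have "finite (states (run_machine K))"
    by (rule finite_subset[OF st]) (use fm fb in auto)
  moreover have "alphabet (run_machine K) = {0, 1}" "tapes (run_machine K) = Suc K" "blank (run_machine K) = 0"
    by (simp_all add: run_machine_def)
  moreover have "start (run_machine K) \<in> states (run_machine K)" "final (run_machine K) \<subseteq> states (run_machine K)"
    "ex_states (run_machine K) \<inter> all_states (run_machine K) = {}"
    by (auto simp: run_machine_def states_def)
  ultimately show ?thesis unfolding ratm_def by auto
qed

section \<open>The clock tapes as an odometer\<close>

definition marks :: "nat \<Rightarrow> int \<Rightarrow> nat" where
  "marks l p = (if 0 \<le> p \<and> p < int l then 1 else 0)"

text \<open>
  The heads of the clock tapes run back and forth between \<open>-1\<close> and \<open>l\<close>.  A head that has made
  \<open>v\<close> moves since it last turned is at \<open>v\<close> when heading right and at \<open>l - 1 - v\<close> when heading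
  left; so it reads a blank iff \<open>v = l\<close>, and the tapes are an odometer with digits \<open>0, \<dots>, l\<close>.
\<close>

definition clock_pos :: "nat \<Rightarrow> bool \<Rightarrow> nat \<Rightarrow> int" where
  "clock_pos l d v = (if d then int v else int l - 1 - int v)"

fun advance :: "nat \<Rightarrow> nat list \<Rightarrow> nat list" where
  "advance l [] = []"
| "advance l (v # vs) = (if v < l then Suc v # vs else 0 # advance l vs)"

text \<open>The number of ticks until all digits equal \<open>l\<close>, least significant digit
  first. In base \<open>l + 1\<close> it is the complement of the reading, so the zero clock has
  \<open>Suc l ^ K - 1\<close> ticks left.\<close>

fun remaining :: "nat \<Rightarrow> nat list \<Rightarrow> nat" where
  "remaining l [] = 0"
| "remaining l (v # vs) = (l - v) + Suc l * remaining l vs"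

lemma length_advance [simp]: "length (advance l vs) = length vs"
  by (induction vs) auto

lemma set_advance: "set vs \<subseteq> {..l} \<Longrightarrow> set (advance l vs) \<subseteq> {..l}"
  by (induction vs) auto

lemma remaining_advance:
  assumes "set vs \<subseteq> {..l}" "remaining l vs \<noteq> 0"
  shows "remaining l vs = Suc (remaining l (advance l vs))"
  using assms
proof (induction vs)
  case (Cons v vs)
  show ?case
  proof (cases "v < l")
    case False
    with Cons have "remaining l vs = Suc (remaining l (advance l vs))" "v = l" by auto
    then show ?thesis by simp
  qed auto
qed simp

lemma remaining_replicate_0: "Suc (remaining l (replicate K 0)) = Suc l ^ K"
proof (induction K)
  case (Suc K)
  have "Suc (remaining l (replicate (Suc K) 0)) = Suc l * Suc (remaining l (replicate K 0))" by simp
  then show ?case using Suc.IH by simp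
qed simp

definition clock :: "nat \<Rightarrow> bool list \<Rightarrow> nat list \<Rightarrow> ((int \<Rightarrow> nat) \<times> int) list" where
  "clock l ds vs = map2 (\<lambda>d v. (marks l, clock_pos l d v)) ds vs"

definition scan :: "((int \<Rightarrow> nat) \<times> int) list \<Rightarrow> nat list" where
  "scan = map (\<lambda>(f, p). f p)"

definition apply_acts :: "(nat \<times> dir) list \<Rightarrow> ((int \<Rightarrow> nat) \<times> int) list \<Rightarrow> ((int \<Rightarrow> nat) \<times> int) list" where
  "apply_acts = map2 (\<lambda>(s, d) (f, p). (f(p := s), move_work d p))"

lemma apply_acts_simps [simp]:
  "apply_acts [] ts = []"
  "apply_acts ((s, d) # as) ((f, p) # ts) = (f(p := s), move_work d p) # apply_acts as ts"
  by (simp_all add: apply_acts_def)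

lemma scan_simps [simp]: "scan [] = []" "scan ((f, p) # ts) = f p # scan ts"
  by (simp_all add: scan_def)

lemma apply_acts_keep [simp]: "apply_acts (keep (scan ts)) ts = ts"
  by (induction ts) (auto simp: keep_def)

lemma keep_Cons [simp]: "keep (s # ss) = (s, Stay) # keep ss"
  by (simp add: keep_def)

lemma marks_clock_pos: "v \<le> l \<Longrightarrow> marks l (clock_pos l d v) = 0 \<longleftrightarrow> v = l"
  by (auto simp: marks_def clock_pos_def)

lemma clock_Cons [simp]: "clock l (d # ds) (v # vs) = (marks l, clock_pos l d v) # clock l ds vs"
  by (simp add: clock_def)

lemma clock_Nil: "clock l [] [] = []"
  by (simp add: clock_def)

lemma length_scan_clock [simp]: "length ds = length vs \<Longrightarrow> length (scan (clock l ds vs)) = length vs"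
  by (simp add: clock_def scan_def)

lemma scan_clock_blank:
  assumes "length ds = length vs" "set vs \<subseteq> {..l}"
  shows "(\<forall>s\<in>set (scan (clock l ds vs)). s = 0) \<longleftrightarrow> remaining l vs = 0"
  using assms
  by (induction ds vs rule: list_induct2) (auto simp: marks_clock_pos clock_Nil)

lemma move_clock:
  assumes "v < l"
  shows "move_work (heading d) (clock_pos l d v) = clock_pos l d (Suc v)"
  by (auto simp: heading_def clock_pos_def)

text \<open>The head of a full digit is one cell past the marks, at \<open>l\<close> or
  \<open>-1\<close>. One move back puts it on \<open>l - 1\<close> or \<open>0\<close>, which is
  digit 0 for the reversed direction, so no time goes into rewinding.\<close>

lemma turn_clock: "move_work (heading (\<not> d)) (clock_pos l d l) = clock_pos l (\<not> d) 0"
  by (auto simp: heading_def clock_pos_def)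

lemma tick_clock:
  assumes "length ds = length vs" "set vs \<subseteq> {..l}"
  shows "apply_acts (tick ds (scan (clock l ds vs))) (clock l ds vs) =
    clock l (turn ds (scan (clock l ds vs))) (advance l vs)"
  using assms
proof (induction ds vs rule: list_induct2)
  case Nil
  then show ?case by (simp add: clock_Nil keep_def)
next
  case (Cons d ds v vs)
  then show ?case
    using marks_clock_pos[of v l d] by (cases "v = l") (auto simp: move_clock turn_clock)
qed

section \<open>The binary value of the address tape\<close>

lemma addr_value_eq_sum:
  "addr_value bs = (\<Sum>i<length bs. of_bool (bs ! i) * 2 ^ (length bs - 1 - i))"
proof -
  have "addr_value bs = (\<Sum>i<length bs. of_bool (bs ! (length bs - Suc i)) * 2 ^ i)"
    by (simp add: addr_value_def horner_sum_eq_sum rev_nth atLeast0LessThan)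
  also have "\<dots> = (\<Sum>i<length bs. of_bool (bs ! i) * 2 ^ (length bs - 1 - i))"
    by (rule sum.reindex_bij_witness[of _ "\<lambda>i. length bs - Suc i" "\<lambda>i. length bs - Suc i"]) auto
  finally show ?thesis .
qed

lemma addr_value_set_True:
  assumes "p < length bs" "\<not> bs ! p"
  shows "addr_value (bs[p := True]) = addr_value bs + 2 ^ (length bs - 1 - p)"
proof -
  have "(\<Sum>i\<in>{..<length bs} - {p}. of_bool (bs[p := True] ! i) * 2 ^ (length bs - 1 - i)) =
      (\<Sum>i\<in>{..<length bs} - {p}. of_bool (bs ! i) * 2 ^ (length bs - 1 - i) :: nat)"
    by (intro sum.cong) auto
  then show ?thesis using assms
    by (simp add: addr_value_eq_sum sum.remove[of "{..<length bs}" p] del: sum_mult_of_bool_eq sum_of_bool_mult_eq)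
qed

lemma addr_value_set_False:
  assumes "p < length bs" "bs ! p"
  shows "addr_value bs = addr_value (bs[p := False]) + 2 ^ (length bs - 1 - p)"
  using addr_value_set_True[of p "bs[p := False]"] assms list_update_id[of bs p] by simp

lemma addr_value_surj:
  assumes "v < 2 ^ l"
  shows "\<exists>bs. length bs = l \<and> addr_value bs = v"
proof (intro exI conjI)
  show "addr_value (rev (map (bit v) [0..<l])) = v"
    using assms by (simp add: addr_value_def horner_sum_bit_eq_take_bit take_bit_nat_eq_self)
qed simp

lemma addr_value_less: "addr_value bs < 2 ^ length bs"
  using horner_sum_of_bool_2_less[of "rev bs"] by (simp add: addr_value_def)

definition ones :: "bool list \<Rightarrow> nat" where
  "ones bs = count_list bs True"

lemma ones_le: "ones bs \<le> length bs"
  by (simp add: ones_def count_le_length)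

lemma ones_set_True:
  assumes "p < length bs" "\<not> bs ! p"
  shows "ones (bs[p := True]) = Suc (ones bs)"
  using assms unfolding ones_def
  by (induction bs arbitrary: p) (auto simp: nth_Cons' split: nat.splits if_splits)

lemma ones_set_False:
  assumes "p < length bs" "bs ! p"
  shows "ones bs = Suc (ones (bs[p := False]))"
  using ones_set_True[of p "bs[p := False]"] assms list_update_id[of bs p] by simp

subsection \<open>Correctness and running time of the machine\<close>

text \<open>\<open>Q\<close> is the condition under which \<open>c\<close> should accept. Joining
  acceptance with the time bound lets both be derived together, backwards from the end of the
  computation.\<close>

definition decides :: "machine \<Rightarrow> bool list \<Rightarrow> nat \<Rightarrow> config \<Rightarrow> bool \<Rightarrow> bool" where
  "decides M w t c Q \<longleftrightarrow> (accepting M w c \<longleftrightarrow> Q) \<and>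
     (Q \<longrightarrow> accepting_within M w t (if state c \<in> ex_states M then 2 else 1) c)"

lemma decides_final: "state c \<in> final M \<Longrightarrow> decides M w t c True"
  by (auto simp: decides_def intro: accepting.final accepting_within.final)

lemma decides_universal:
  assumes c: "state c \<in> all_states M" "state c \<notin> final M" and M: "ex_states M \<inter> all_states M = {}"
    and step: "\<And>c'. step M w c c' \<longleftrightarrow> (\<exists>i. c' = d i)"
    and d: "\<And>i. decides M w t (d i) (Q i)" "\<And>i. state (d i) \<notin> ex_states M"
    and t: "t < t'"
  shows "decides M w t' c (\<forall>i. Q i)"
proof -
  have ex: "state c \<notin> ex_states M" using c M by auto
  have "accepting M w c \<longleftrightarrow> (\<forall>i. accepting M w (d i))"
  proof
    assume "accepting M w c"
    then show "\<forall>i. accepting M w (d i)"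
      using c(2) ex step by cases auto
  next
    assume "\<forall>i. accepting M w (d i)"
    then show "accepting M w c"
      \<comment> \<open>Types are nonempty, so \<open>d undefined\<close> is the successor that rule
        \<open>all\<close> demands.\<close>
      by (intro accepting.all[OF c(1), of w "d undefined"]) (auto simp: step)
  qed
  moreover have "accepting_within M w t' 1 c" if "\<forall>i. Q i"
  proof -
    have "accepting_within M w (Suc t) 1 c"
    proof (rule accepting_within.all[OF c(1)])
      show "step M w c (d undefined)" by (auto simp: step)
      fix c' assume "step M w c c'"
      then obtain i where "c' = d i" by (auto simp: step)
      then show "accepting_within M w t (blocks_left M c c' 1) c'"
        using d that ex by (simp add: decides_def blocks_left_def)
    qed
    then show ?thesis using t by (auto intro: accepting_within_mono)
  qed
  ultimately show ?thesis using d(1) ex by (simp add: decides_def)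
qed

lemma decides_step:
  assumes "state c \<in> all_states M" "state c \<notin> final M" "ex_states M \<inter> all_states M = {}"
    and "\<And>c'. step M w c c' \<longleftrightarrow> c' = d" "decides M w t d Q" "state d \<notin> ex_states M" "t < t'"
  shows "decides M w t' c Q"
  using decides_universal[OF assms(1-3), of w "\<lambda>_ :: unit. d" t "\<lambda>_. Q" t'] assms(4-7) by simp

text \<open>Rule \<open>all\<close> asks for at least one step, so a universal configuration without
  successors rejects. This is how the machine rejects when the clock has run out.\<close>

lemma decides_stuck:
  assumes "state c \<in> all_states M" "state c \<notin> final M" "ex_states M \<inter> all_states M = {}"
    and "\<And>c'. \<not> step M w c c'"
  shows "decides M w t c False"
proof -
  have "\<not> accepting M w c"
  proof
    assume "accepting M w c"
    then show False using assms by cases auto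
  qed
  then show ?thesis by (simp add: decides_def)
qed

lemma decides_existential:
  assumes c: "state c \<in> ex_states M" "state c \<notin> final M" and M: "ex_states M \<inter> all_states M = {}"
    and step: "\<And>c'. step M w c c' \<longleftrightarrow> c' = d"
    and d: "decides M w t d Q" and t: "t < t'"
  shows "decides M w t' c Q"
proof -
  have "accepting M w c \<longleftrightarrow> accepting M w d"
  proof
    assume "accepting M w c"
    then show "accepting M w d" using c M step by cases auto
  next
    assume "accepting M w d"
    then show "accepting M w c" by (intro accepting.ex[OF c(1), of w d]) (auto simp: step)
  qed
  moreover have "accepting_within M w t' 2 c" if Q
  proof -
    have "accepting_within M w (Suc t) 2 c"
      using d that c(1)
      by (intro accepting_within.ex[OF c(1), of w d]) (auto simp: step decides_def blocks_left_def split: if_splits)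
    then show ?thesis using t by (auto intro: accepting_within_mono)
  qed
  ultimately show ?thesis using d c(1) by (simp add: decides_def)
qed

text \<open>Work head \<open>0\<close> follows the address head but may go on to \<open>-1\<close>
  and \<open>l\<close>, where the address head stays put; hence the minimum, and \<open>nat\<close>
  for the left end.\<close>

definition running :: "nat \<Rightarrow> mode \<Rightarrow> bool list \<Rightarrow> int \<Rightarrow> bool list \<Rightarrow> nat list \<Rightarrow> config" where
  "running l md bs p ds vs = \<lparr>state = code md ds, addr = bs, addr_head = nat (min p (int l - 1)),
     work = (marks l, p) # clock l ds vs\<rparr>"

definition measuring :: "nat \<Rightarrow> nat \<Rightarrow> nat \<Rightarrow> config" where
  "measuring K l j = \<lparr>state = code Measure (replicate K False),
     addr = replicate j True @ replicate (l - j) False, addr_head = min j (l - 1),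
     work = replicate (Suc K) (marks j, int j)\<rparr>"

lemma run_machine_states [simp]:
  "code md ds \<in> ex_states (run_machine K) \<longleftrightarrow> md = Measure \<and> ds = replicate K False"
  "code md ds \<in> all_states (run_machine K) \<longleftrightarrow> md \<noteq> Measure \<and> length ds = K"
  "code md ds \<in> final (run_machine K) \<longleftrightarrow> md = Accept \<and> length ds = K"
  "ex_states (run_machine K) \<inter> all_states (run_machine K) = {}"
  by (auto simp: run_machine_def)

lemma state_running [simp]: "state (running l md bs p ds vs) = code md ds"
  by (simp add: running_def)

lemma step_running:
  assumes "length bs = l" "l > 0"
  shows "step (run_machine K) w (running l md bs p ds vs) c' \<longleftrightarrow>
    (\<exists>a\<in>moves md ds (cell w (addr_value bs)) (bs ! nat (min p (int l - 1)))
        (marks l p) (scan (clock l ds vs)).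
      c' = \<lparr>state = next_state a, addr = bs[nat (min p (int l - 1)) := addr_write a],
        addr_head = move_addr l (addr_dir a) (nat (min p (int l - 1))),
        work = apply_acts (work_acts a) ((marks l, p) # clock l ds vs)\<rparr>)"
proof -
  have "nat (min p (int l - 1)) < l" using assms(2) by (auto simp: min_def)
  then show ?thesis using assms(1)
    by (simp add: step_def running_def run_machine_def read_input_cell read_addr_def read_work_def
        scan_def apply_action_def apply_acts_def)
qed

lemma marks_update [simp]:
  "0 \<le> p \<Longrightarrow> p < int l \<Longrightarrow> (marks l)(p := Suc 0) = marks l"
  "p < 0 \<or> p \<ge> int l \<Longrightarrow> (marks l)(p := 0) = marks l"
  by (auto simp: marks_def)

context
  fixes K l :: nat and w :: "bool list"
  assumes l: "l > 0" and w: "length w \<le> 2 ^ l"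
begin

private abbreviation (input) M where "M \<equiv> run_machine K"

private definition valid :: "bool list \<Rightarrow> bool list \<Rightarrow> nat list \<Rightarrow> bool" where
  "valid bs ds vs \<longleftrightarrow> length bs = l \<and> length ds = K \<and> length vs = K \<and> set vs \<subseteq> {..l}"

text \<open>The window has \<open>r + 1\<close> cells because \<open>r\<close> ticks of the clock
  separate \<open>r + 1\<close> tests. The endmark counts as a hit.\<close>

private definition hit :: "nat \<Rightarrow> nat \<Rightarrow> bool" where
  "hit v r \<longleftrightarrow> (\<exists>i\<le>r. cell w (v + i) \<noteq> Bit False)"

lemma hit_Suc: "hit v (Suc r) \<longleftrightarrow> cell w v \<noteq> Bit False \<or> hit (Suc v) r"
proof -
  have "hit v (Suc r) \<longleftrightarrow> (\<exists>i\<in>{..Suc r}. cell w (v + i) \<noteq> Bit False)" by (auto simp: hit_def)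
  then show ?thesis unfolding atMost_Suc_eq_insert_0 by (auto simp: hit_def)
qed

lemma hit_0: "hit v 0 \<longleftrightarrow> cell w v \<noteq> Bit False"
  by (simp add: hit_def)

lemma hit_overflow: "v \<ge> 2 ^ l \<Longrightarrow> hit v r"
  using w by (auto simp: hit_def cell_def)

section \<open>Single steps of the phases\<close>

lemma step_Fill:
  assumes "valid bs ds vs" "0 \<le> p" "p < int l"
  shows "step M w (running l Fill bs p ds vs) c' \<longleftrightarrow>
    (\<exists>b. c' = running l Fill (bs[nat p := b]) (p - 1) ds vs)"
  using assms by (subst step_running) (auto simp: valid_def running_def marks_def nat_diff_distrib)

lemma step_Fill_end:
  assumes "valid bs ds vs"
  shows "step M w (running l Fill bs (-1) ds vs) c' \<longleftrightarrow> c' = running l Return bs 0 ds vs"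
  using assms l by (subst step_running) (auto simp: valid_def running_def marks_def)

lemma step_Return:
  assumes "valid bs ds vs" "0 \<le> p" "p < int l"
  shows "step M w (running l Return bs p ds vs) c' \<longleftrightarrow> c' = running l Return bs (p + 1) ds vs"
proof -
  have "nat (min (p + 1) (int l - 1)) = (if Suc (nat p) < l then Suc (nat p) else nat p)"
    using assms by auto
  then show ?thesis
    using assms by (subst step_running) (auto simp: valid_def running_def marks_def min_def)
qed

lemma step_Return_end:
  assumes "valid bs ds vs"
  shows "step M w (running l Return bs (int l) ds vs) c' \<longleftrightarrow> c' = running l Test bs (int l - 1) ds vs"
  using assms l by (subst step_running) (auto simp: valid_def running_def marks_def)

lemma step_Test_found:
  assumes "valid bs ds vs" "cell w (addr_value bs) \<noteq> Bit False"
  shows "step M w (running l Test bs (int l - 1) ds vs) c' \<longleftrightarrow> c' = running l Accept bs (int l - 1) ds vs"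
  using assms l by (subst step_running) (auto simp: valid_def running_def marks_def)

lemma step_Test_timeout:
  assumes "valid bs ds vs" "cell w (addr_value bs) = Bit False" "remaining l vs = 0"
  shows "\<not> step M w (running l Test bs (int l - 1) ds vs) c'"
  using assms l scan_clock_blank[of ds vs l] by (subst step_running) (auto simp: valid_def)

lemma step_Test_next:
  assumes "valid bs ds vs" "cell w (addr_value bs) = Bit False" "remaining l vs \<noteq> 0"
  shows "step M w (running l Test bs (int l - 1) ds vs) c' \<longleftrightarrow>
    c' = running l Carry bs (int l - 1) (turn ds (scan (clock l ds vs))) (advance l vs)"
  using assms l scan_clock_blank[of ds vs l] tick_clock[of ds vs l]
  by (subst step_running) (auto simp: valid_def running_def)

lemma step_Carry_True:
  assumes "valid bs ds vs" "0 \<le> p" "p < int l" "bs ! nat p"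
  shows "step M w (running l Carry bs p ds vs) c' \<longleftrightarrow>
    c' = running l Carry (bs[nat p := False]) (p - 1) ds vs"
  using assms by (subst step_running) (auto simp: valid_def running_def marks_def nat_diff_distrib)

lemma step_Carry_False:
  assumes "valid bs ds vs" "0 \<le> p" "p < int l" "\<not> bs ! nat p"
  shows "step M w (running l Carry bs p ds vs) c' \<longleftrightarrow>
    c' = running l Return (bs[nat p := True]) p ds vs"
  using assms by (subst step_running) (auto simp: valid_def running_def marks_def)

lemma step_Carry_overflow:
  assumes "valid bs ds vs"
  shows "step M w (running l Carry bs (-1) ds vs) c' \<longleftrightarrow> c' = running l Accept bs (-1) ds vs"
  using assms l by (subst step_running) (auto simp: valid_def running_def marks_def)

section \<open>Acceptance and time, phase by phase\<close>

lemma valid_update: "valid bs ds vs \<Longrightarrow> valid (bs[p := b]) ds vs"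
  by (simp add: valid_def)

lemma valid_advance: "valid bs ds vs \<Longrightarrow> valid bs (turn ds ss) (advance l vs)"
  by (simp add: valid_def set_advance)

lemma decides_Accept: "valid bs ds vs \<Longrightarrow> decides M w t (running l Accept bs p ds vs) True"
  by (intro decides_final) (simp add: valid_def)

lemma decides_Return:
  assumes "p \<le> int l" "valid bs ds vs" "0 \<le> p"
    and "decides M w t (running l Test bs (int l - 1) ds vs) Q"
  shows "decides M w (t + nat (int l - p) + 1) (running l Return bs p ds vs) Q"
  using assms
proof (induction p rule: int_le_induct)
  case base
  show ?case
    by (rule decides_step[OF _ _ _ step_Return_end[OF base(1)] base(3)]) (use base in \<open>auto simp: valid_def\<close>)
next
  case (step p)
  have "decides M w (t + nat (int l - p) + 1) (running l Return bs p ds vs) Q"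
    using step by simp
  moreover have "step M w (running l Return bs (p - 1) ds vs) c' \<longleftrightarrow> c' = running l Return bs p ds vs" for c'
    using step_Return[of bs ds vs "p - 1" c'] step by simp
  ultimately show ?case
    using step by (intro decides_step[of "running l Return bs (p - 1) ds vs"]) (auto simp: valid_def)
qed

text \<open>
  While \<open>Carry\<close> is at position \<open>p\<close>, the summand \<open>2 ^ (l - 1 - p)\<close> is still to be added to the
  address.  The term \<open>2 * ones bs\<close> of the time bound pays for the long carries.
\<close>

lemma decides_Carry:
  assumes "-1 \<le> p" "p < int l" "valid bs ds vs"
    and "\<And>bs. valid bs ds vs \<Longrightarrow>
      decides M w (t + 2 * ones bs) (running l Test bs (int l - 1) ds vs) (hit (addr_value bs) r)"
  shows "decides M w (t + 2 * ones bs + nat (int l - p) + 4) (running l Carry bs p ds vs)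
    (hit (addr_value bs + 2 ^ nat (int l - 1 - p)) r)"
  using assms
proof (induction p arbitrary: bs rule: int_ge_induct)
  case base
  have "hit (addr_value bs + 2 ^ nat (int l - 1 - -1)) r" by (intro hit_overflow) simp
  moreover have "decides M w (t + 2 * ones bs + nat (int l - -1) + 4) (running l Carry bs (-1) ds vs) True"
    by (rule decides_step[OF _ _ _ step_Carry_overflow[OF base(2)] decides_Accept[OF base(2), of 0]])
      (use base in \<open>auto simp: valid_def\<close>)
  ultimately show ?case by simp
next
  case (step p)
  let ?p = "nat (p + 1)"
  have len: "length bs = l" "?p < length bs" using step.prems step.hyps by (auto simp: valid_def)
  have nat: "nat (int l - 1 - (p + 1)) = l - 1 - ?p" "nat (int l - 1 - p) = Suc (l - 1 - ?p)"
    using step.prems step.hyps by auto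
  show ?case
  proof (cases "bs ! ?p")
    case True
    have "decides M w (t + 2 * ones (bs[?p := False]) + nat (int l - p) + 4)
      (running l Carry (bs[?p := False]) p ds vs)
      (hit (addr_value (bs[?p := False]) + 2 ^ nat (int l - 1 - p)) r)"
      using step.prems by (intro step.IH) (auto intro: valid_update)
    moreover have "addr_value (bs[?p := False]) + 2 ^ nat (int l - 1 - p) =
        addr_value bs + 2 ^ nat (int l - 1 - (p + 1))"
      using addr_value_set_False[OF len(2) True] len nat by simp
    ultimately have IH: "decides M w (t + 2 * ones (bs[?p := False]) + nat (int l - p) + 4)
      (running l Carry (bs[?p := False]) p ds vs)
      (hit (addr_value bs + 2 ^ nat (int l - 1 - (p + 1))) r)" by metis
    have "step M w (running l Carry bs (p + 1) ds vs) c' \<longleftrightarrow>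
      c' = running l Carry (bs[?p := False]) p ds vs" for c'
      using step_Carry_True[of bs ds vs "p + 1" c'] step.prems step.hyps True by simp
    \<comment> \<open>Clearing a one frees 2 units: one for this step, one because the distance
      \<open>int l - p\<close> has grown.\<close>
    from decides_step[OF _ _ _ this IH] show ?thesis
      using step.prems step.hyps ones_set_False[OF len(2) True] by (auto simp: valid_def)
  next
    case False
    have val: "addr_value (bs[?p := True]) = addr_value bs + 2 ^ nat (int l - 1 - (p + 1))"
      using addr_value_set_True[OF len(2) False] len nat by simp
    have v: "valid (bs[?p := True]) ds vs" using step.prems by (auto intro: valid_update)
    have "decides M w (t + 2 * ones (bs[?p := True]) + nat (int l - (p + 1)) + 1)
      (running l Return (bs[?p := True]) (p + 1) ds vs) (hit (addr_value (bs[?p := True])) r)"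
      using step.prems step.hyps by (intro decides_Return v step.prems(3)) auto
    then have IH: "decides M w (t + 2 * ones (bs[?p := True]) + nat (int l - (p + 1)) + 1)
      (running l Return (bs[?p := True]) (p + 1) ds vs) (hit (addr_value bs + 2 ^ nat (int l - 1 - (p + 1))) r)"
      by (simp only: val)
    \<comment> \<open>The new one costs 2 units, this step and the last step of
      \<open>Return\<close> one each: together the constant 4.\<close>
    from decides_step[OF _ _ _ step_Carry_False this] show ?thesis
      using step.prems step.hyps ones_set_True[OF len(2) False] False by (auto simp: valid_def)
  qed
qed

text \<open>Each tick costs 6 units: one for the step of \<open>Test\<close>, and
  \<open>1 + 4\<close> for \<open>Carry\<close> started at the last cell, including the way back.
  Longer carries are charged to \<open>ones bs\<close>.\<close>

lemma decides_Test:
  assumes "valid bs ds vs"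
  shows "decides M w (6 * remaining l vs + 1 + 2 * ones bs) (running l Test bs (int l - 1) ds vs)
    (hit (addr_value bs) (remaining l vs))"
  using assms
proof (induction "remaining l vs" arbitrary: bs ds vs)
  case 0
  show ?case
  proof (cases "cell w (addr_value bs) = Bit False")
    case True
    have "decides M w (6 * remaining l vs + 1 + 2 * ones bs) (running l Test bs (int l - 1) ds vs) False"
      using 0 True step_Test_timeout[of bs ds vs] by (intro decides_stuck) (auto simp: valid_def)
    then show ?thesis using 0 True by (simp add: hit_0 flip: 0(1))
  next
    case False
    have "decides M w (6 * remaining l vs + 1 + 2 * ones bs) (running l Test bs (int l - 1) ds vs) True"
      by (rule decides_step[OF _ _ _ step_Test_found[OF 0(2) False] decides_Accept[OF 0(2), of 0]])
        (use 0 in \<open>auto simp: valid_def\<close>)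
    then show ?thesis using 0 False by (simp add: hit_0 flip: 0(1))
  qed
next
  case (Suc r)
  show ?case
  proof (cases "cell w (addr_value bs) = Bit False")
    case True
    let ?ds = "turn ds (scan (clock l ds vs))" and ?vs = "advance l vs"
    have r: "r = remaining l ?vs"
      using Suc.hyps(2) remaining_advance[of vs l] Suc.prems by (simp add: valid_def)
    have v: "valid bs ?ds ?vs" using Suc.prems by (rule valid_advance)
    have "decides M w (6 * r + 1 + 2 * ones bs + nat (int l - (int l - 1)) + 4)
      (running l Carry bs (int l - 1) ?ds ?vs) (hit (addr_value bs + 2 ^ nat (int l - 1 - (int l - 1))) r)"
      using l v Suc.hyps(1)[OF r] r by (intro decides_Carry) auto
    then have *: "decides M w (6 * r + 2 * ones bs + 6)
      (running l Carry bs (int l - 1) ?ds ?vs) (hit (Suc (addr_value bs)) r)" by (simp add: ac_simps)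
    have "decides M w (6 * remaining l vs + 1 + 2 * ones bs) (running l Test bs (int l - 1) ds vs)
      (hit (Suc (addr_value bs)) r)"
      by (rule decides_step[OF _ _ _ step_Test_next[OF Suc.prems True] *])
        (use Suc.prems Suc.hyps(2)[symmetric] in \<open>auto simp: valid_def\<close>)
    then show ?thesis using True by (simp add: hit_Suc flip: Suc.hyps(2))
  next
    case False
    have "decides M w (6 * remaining l vs + 1 + 2 * ones bs) (running l Test bs (int l - 1) ds vs) True"
      by (rule decides_step[OF _ _ _ step_Test_found[OF Suc.prems False] decides_Accept[OF Suc.prems, of 0]])
        (use Suc.prems in \<open>auto simp: valid_def\<close>)
    then show ?thesis using False by (simp add: hit_Suc flip: Suc.hyps(2))
  qed
qed

text \<open>The cells up to \<open>p\<close> are still to be chosen universally and those to its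
  right are fixed, so the condition ranges over all \<open>bs'\<close> that agree with
  \<open>bs\<close> beyond \<open>p\<close>.\<close>

lemma decides_Fill:
  assumes "-1 \<le> p" "p < int l" "valid bs ds vs"
    and "\<And>bs. valid bs ds vs \<Longrightarrow> decides M w t (running l Return bs 0 ds vs) (Q bs)"
  shows "decides M w (t + nat (p + 2)) (running l Fill bs p ds vs)
    (\<forall>bs'. length bs' = l \<and> (\<forall>i<l. int i > p \<longrightarrow> bs' ! i = bs ! i) \<longrightarrow> Q bs')"
  using assms
proof (induction p arbitrary: bs rule: int_ge_induct)
  case base
  have "(\<forall>bs'. length bs' = l \<and> (\<forall>i<l. int i > - 1 \<longrightarrow> bs' ! i = bs ! i) \<longrightarrow> Q bs') \<longleftrightarrow> Q bs"
  proof -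
    have "bs' = bs" if "length bs' = l" "\<forall>i<l. int i > - 1 \<longrightarrow> bs' ! i = bs ! i" for bs'
      using that base(2) by (intro nth_equalityI) (auto simp: valid_def)
    then show ?thesis using base(2) by (auto simp: valid_def)
  qed
  moreover have "decides M w (t + nat (- 1 + 2)) (running l Fill bs (- 1) ds vs) (Q bs)"
    by (rule decides_step[OF _ _ _ step_Fill_end[OF base(2)] base(3)[OF base(2)]])
      (use base in \<open>auto simp: valid_def\<close>)
  ultimately show ?case by simp
next
  case (step p)
  let ?bs = "\<lambda>b. bs[nat (p + 1) := b]"
  have st: "step M w (running l Fill bs (p + 1) ds vs) c' \<longleftrightarrow>
      (\<exists>b. c' = running l Fill (?bs b) p ds vs)" for c'
    using step_Fill[of bs ds vs "p + 1" c'] step.prems step.hyps by simp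
  have IH: "decides M w (t + nat (p + 2)) (running l Fill (?bs b) p ds vs)
    (\<forall>bs'. length bs' = l \<and> (\<forall>i<l. int i > p \<longrightarrow> bs' ! i = ?bs b ! i) \<longrightarrow> Q bs')" for b
    using step.prems by (intro step.IH) (auto intro: valid_update)
  have "decides M w (t + nat (p + 1 + 2)) (running l Fill bs (p + 1) ds vs)
    (\<forall>b. \<forall>bs'. length bs' = l \<and> (\<forall>i<l. int i > p \<longrightarrow> bs' ! i = ?bs b ! i) \<longrightarrow> Q bs')"
    by (rule decides_universal[OF _ _ _ st IH]) (use step.prems step.hyps in \<open>auto simp: valid_def\<close>)
  \<comment> \<open>Choosing \<open>b\<close> and then the cells up to \<open>p\<close> amounts to
    choosing all cells up to \<open>p + 1\<close>.\<close>
  moreover have "(\<forall>i<l. int i > p \<longrightarrow> bs' ! i = ?bs b ! i) \<longleftrightarrow>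
      (\<forall>i<l. int i > p + 1 \<longrightarrow> bs' ! i = bs ! i) \<and> bs' ! nat (p + 1) = b" if "length bs' = l" for b bs'
  proof -
    have "int i > p \<longleftrightarrow> int i > p + 1 \<or> i = nat (p + 1)" for i
      using step.hyps by auto
    then show ?thesis using step.prems step.hyps by (auto simp: valid_def nth_list_update)
  qed
  ultimately show ?case by (smt (verit))
qed

lemma step_measuring:
  assumes "j < l"
  shows "step M w (measuring K l j) c' \<longleftrightarrow> c' = measuring K l (Suc j)"
proof -
  have "(replicate j True @ replicate (l - j) False)[j := True] = replicate (Suc j) True @ replicate (l - Suc j) False"
    using assms by (intro nth_equalityI) (auto simp: nth_append nth_list_update simp del: replicate_Suc)
  moreover have "(marks j)(int j := 1) = marks (Suc j)" by (auto simp: marks_def)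
  moreover have "apply_acts (replicate k (1, Right)) (replicate k (marks j, int j)) =
      replicate k ((marks j)(int j := 1), int j + 1)" for k
    by (induction k) auto
  ultimately show ?thesis using assms
    by (auto simp: step_def measuring_def run_machine_def read_input_cell read_addr_def read_work_def
      apply_action_def map_replicate_const nth_append simp flip: apply_acts_def)
qed

lemma step_measuring_end:
  "step M w (measuring K l l) c' \<longleftrightarrow>
    c' = running l Fill (replicate l True) (int l - 1) (replicate K False) (replicate K 0)"
proof -
  have m: "marks l (int l) = 0" by (simp add: marks_def)
  then have "(marks l)(int l := 0) = marks l" by auto
  with m have "apply_acts (replicate k (0, Left)) (replicate k (marks l, int l)) = replicate k (marks l, int l - 1)" for k
    by (induction k) auto
  moreover have "clock l (replicate k False) (replicate k 0) = replicate k (marks l, int l - 1)" for k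
    by (induction k) (auto simp: clock_Nil clock_pos_def)
  moreover have "(replicate l True)[l - 1 := True] = replicate l True"
    by (intro nth_equalityI) (auto simp: nth_list_update)
  ultimately show ?thesis using l m \<open>(marks l)(int l := 0) = marks l\<close>
    by (auto simp: step_def measuring_def run_machine_def read_input_cell read_addr_def read_work_def
      apply_action_def running_def simp flip: apply_acts_def)
qed

lemma decides_measuring:
  assumes "j \<le> l"
    and "decides M w t (running l Fill (replicate l True) (int l - 1) (replicate K False) (replicate K 0)) Q"
  shows "decides M w (t + (l - j) + 1) (measuring K l j) Q"
  using assms
proof (induction j rule: inc_induct)
  case base
  show ?case
    by (rule decides_existential[OF _ _ _ step_measuring_end base]) (simp_all add: measuring_def)
next
  case (step j)
  show ?case
    by (rule decides_existential[OF _ _ _ step_measuring step.IH])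
      (use step in \<open>simp_all add: measuring_def\<close>)
qed

lemma decides_run_machine:
  "decides M w (11 * Suc l ^ K + 5 * l) (measuring K l 0)
    (\<forall>v<2 ^ l. \<exists>i<Suc l ^ K. cell w (v + i) \<noteq> Bit False)"
proof -
  define ds where "ds = replicate K False"
  define vs where "vs = replicate K (0::nat)"
  define r where "r = remaining l vs"
  have r: "Suc r = Suc l ^ K" by (simp add: r_def vs_def remaining_replicate_0)
  have "decides M w (6 * r + 3 * l + 2) (running l Return bs 0 ds vs) (hit (addr_value bs) r)"
    if v: "valid bs ds vs" for bs
  proof -
    have "decides M w (6 * r + 1 + 2 * ones bs + nat (int l - 0) + 1) (running l Return bs 0 ds vs)
        (hit (addr_value bs) r)"
      unfolding r_def using v by (intro decides_Return decides_Test) auto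
    then show ?thesis using ones_le[of bs] v
      by (auto simp: decides_def valid_def intro: accepting_within_mono)
  qed
  then have "decides M w (6 * r + 3 * l + 2 + nat (int l - 1 + 2)) (running l Fill (replicate l True) (int l - 1) ds vs)
     (\<forall>bs'. length bs' = l \<and> (\<forall>i<l. int i > int l - 1 \<longrightarrow> bs' ! i = replicate l True ! i) \<longrightarrow>
        hit (addr_value bs') r)"
    using l by (intro decides_Fill) (auto simp: valid_def ds_def vs_def)
  then have "decides M w (6 * r + 3 * l + 2 + nat (int l - 1 + 2) + (l - 0) + 1) (measuring K l 0)
     (\<forall>bs'. length bs' = l \<and> (\<forall>i<l. int i > int l - 1 \<longrightarrow> bs' ! i = replicate l True ! i) \<longrightarrow>
        hit (addr_value bs') r)"
    unfolding ds_def vs_def by (intro decides_measuring) auto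
  moreover have "(\<forall>bs'. length bs' = l \<and> (\<forall>i<l. int i > int l - 1 \<longrightarrow> bs' ! i = replicate l True ! i) \<longrightarrow>
        hit (addr_value bs') r) \<longleftrightarrow> (\<forall>v<2 ^ l. \<exists>i<Suc l ^ K. cell w (v + i) \<noteq> Bit False)"
    unfolding hit_def r[symmetric] less_Suc_eq_le
  proof (intro iffI allI impI)
    fix v :: nat
    assume hyp: "\<forall>bs'. length bs' = l \<and> (\<forall>i<l. int i > int l - 1 \<longrightarrow> bs' ! i = replicate l True ! i) \<longrightarrow>
      (\<exists>i\<le>r. cell w (addr_value bs' + i) \<noteq> Bit False)" and "v < 2 ^ l"
    then obtain bs where "length bs = l" "addr_value bs = v" using addr_value_surj by blast
    with hyp show "\<exists>i\<le>r. cell w (v + i) \<noteq> Bit False" by auto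
  next
    fix bs :: "bool list"
    assume "\<forall>v<2 ^ l. \<exists>i\<le>r. cell w (v + i) \<noteq> Bit False"
      and "length bs = l \<and> (\<forall>i<l. int i > int l - 1 \<longrightarrow> bs ! i = replicate l True ! i)"
    then show "\<exists>i\<le>r. cell w (addr_value bs + i) \<noteq> Bit False" using addr_value_less[of bs] by blast
  qed
  \<comment> \<open>The phases add up to \<open>6 * r + 5 * l + 4\<close>, within the bound because
    \<open>Suc r = Suc l ^ K\<close>.\<close>
  ultimately show ?thesis using r
    by (auto simp: decides_def intro: accepting_within_mono)
qed

end

subsection \<open>Separation\<close>

text \<open>If the address tape has \<open>l > 0\<close> cells, the members are the words without a
  run of \<open>Suc l ^ K\<close> zeros; inputs too short for an address cell are not accepted.
  Taking the language of the machine itself settles the short inputs by definition.\<close>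

definition run_free :: "nat \<Rightarrow> bool list set" where
  "run_free K = {w. accepting (run_machine K) w (init (run_machine K) w)}"

lemma length_le_addr_length: "n \<le> 2 ^ addr_length n"
proof (cases "n = 0")
  case False
  then have "log 2 (real n) \<le> real (addr_length n)"
    by (simp add: addr_length_def)
  then have "real n \<le> 2 powr real (addr_length n)"
    using False by (simp add: log_le_iff)
  also have "\<dots> = real (2 ^ addr_length n)" by (simp add: powr_realpow)
  finally show ?thesis by (simp only: of_nat_le_iff)
qed simp

lemma addr_length_power [simp]: "addr_length (2 ^ l) = l"
  by (simp add: addr_length_def log_nat_power)

lemma init_run_machine: "init (run_machine K) w = measuring K (addr_length (length w)) 0"
proof -
  have "marks 0 = (\<lambda>_. 0)" by (auto simp: marks_def)
  then show ?thesis by (simp add: init_def measuring_def run_machine_def)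
qed

lemma decides_init:
  assumes "addr_length (length w) = l" "l > 0"
  shows "decides (run_machine K) w (11 * Suc l ^ K + 5 * l) (init (run_machine K) w)
    (\<forall>v<2 ^ l. \<exists>i<Suc l ^ K. cell w (v + i) \<noteq> Bit False)"
  using decides_run_machine[of l w] length_le_addr_length[of "length w"] assms
  by (simp add: init_run_machine)

text \<open>
  On an address tape without cells, the machine never reads the \<open>1\<close> for which \<open>Measure\<close> waits.
\<close>

lemma addr_length_run_free:
  assumes "w \<in> run_free K"
  shows "addr_length (length w) > 0"
proof -
  have "addr c \<noteq> []" if "accepting (run_machine K) w c" "state c = code Measure (replicate K False)" for c
    using that
  proof (induction rule: accepting.induct)
    case (ex c c')
    show ?case
    proof
      assume "addr c = []"
      then have "state c' = code Measure (replicate K False)" "addr c' = []"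
        using ex.hyps(2) ex.prems by (auto simp: step_def run_machine_def read_addr_def apply_action_def)
      with ex.IH show False by simp
    qed
  qed auto
  from this[of "init (run_machine K) w"] assms show ?thesis
    by (auto simp: run_free_def init_def run_machine_def)
qed

lemma run_free_in_ATIME:
  assumes "K > 0"
  shows "run_free K \<in> ATIME (\<lambda>n. log 2 (real n) ^ K) 2"
  unfolding ATIME_def
proof (intro CollectI exI conjI ballI)
  define t where "t = (\<lambda>n. 11 * Suc (addr_length n) ^ K + 5 * addr_length n)"
  have start: "start (run_machine K) = code Measure (replicate K False)" by (simp add: run_machine_def)
  show "ratm (run_machine K)" by (rule ratm_run_machine)
  show "start (run_machine K) \<in> ex_states (run_machine K)" by (simp add: start)
  show "run_free K = {w. accepting (run_machine K) w (init (run_machine K) w)}"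
    by (simp add: run_free_def)
  show "accepting_within (run_machine K) w (t (length w)) 2 (init (run_machine K) w)"
    if "w \<in> run_free K" for w
    using decides_init[OF refl addr_length_run_free[OF that], of K] that
    by (simp add: decides_def t_def run_free_def init_run_machine measuring_def)
  show "(\<lambda>n. real (t n)) \<in> O(\<lambda>n. log 2 (real n) ^ K)"
  proof (rule bigoI)
    show "\<forall>\<^sub>F n in sequentially. norm (real (t n)) \<le> 16 * 3 ^ K * norm (log 2 (real n) ^ K)"
      using eventually_ge_at_top[of 2]
    proof eventually_elim
      case (elim n)
      have log: "log 2 (real n) \<ge> 1" using elim by (simp add: le_log_iff)
      have "real (addr_length n) \<le> log 2 (real n) + 1"
        using log by (simp add: addr_length_def)
      then have le: "real (Suc (addr_length n)) \<le> 3 * log 2 (real n)" using log by simp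
      \<comment> \<open>The positive exponent absorbs the linear term of \<open>t\<close>.\<close>
      have "addr_length n \<le> Suc (addr_length n) ^ K"
        using assms self_le_power[of "Suc (addr_length n)" K] by simp
      then have "t n \<le> 16 * Suc (addr_length n) ^ K" by (simp add: t_def)
      then have "real (t n) \<le> 16 * real (Suc (addr_length n)) ^ K"
        by (metis of_nat_le_iff of_nat_mult of_nat_numeral of_nat_power)
      also have "\<dots> \<le> 16 * (3 * log 2 (real n)) ^ K"
        using le by (intro mult_left_mono power_mono) auto
      finally show ?case using log by (simp add: power_mult_distrib)
    qed
  qed
qed

text \<open>A window of \<open>Suc l ^ K\<close> cells starting at a positive offset reaches the
  separator of its block. Only a window at offset 0 misses it, and that one contains the cell chosen
  by \<open>u\<close>. Beyond the \<open>m\<close> blocks there are only ones and the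
  endmark.\<close>

lemma block_word_in_run_free:
  assumes "l > 0" "u \<in> {..<m} \<rightarrow>\<^sub>E {..<Suc l ^ K}"
  shows "block_word (2 ^ l) m (Suc l ^ K) u \<in> run_free K"
proof -
  let ?s = "Suc l ^ K"
  let ?w = "block_word (2 ^ l) m ?s u"
  have "\<exists>i<?s. cell ?w (v + i) \<noteq> Bit False" for v
  proof -
    let ?j = "v div Suc ?s" and ?o = "v mod Suc ?s"
    have v: "v = ?j * Suc ?s + ?o" by (rule div_mult_mod_eq[symmetric])
    show ?thesis
    proof (cases "?o = 0")
      case False
      have eq: "v + (?s - ?o) = ?j * Suc ?s + ?s" using v mod_less_divisor[of "Suc ?s" v]
        by (metis add.assoc le_add_diff_inverse less_Suc_eq_le zero_less_Suc)
      have "(v + (?s - ?o)) mod Suc ?s = ?s"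
        unfolding eq by (simp del: mult_Suc_right)
      then have "cell ?w (v + (?s - ?o)) \<noteq> Bit False"
        by (simp add: cell_def block_word_def)
      then show ?thesis using False by (intro exI[of _ "?s - ?o"]) auto
    next
      case True
      show ?thesis
      proof (cases "?j < m")
        case False
        then have "cell ?w (v + 0) \<noteq> Bit False" by (simp add: cell_def block_word_def)
        then show ?thesis by (intro exI[of _ 0]) simp
      next
        case jm: True
        then have u: "u ?j < ?s" using assms(2) by auto
        have eq: "v + u ?j = ?j * Suc ?s + u ?j" using v True by simp
        have "(v + u ?j) div Suc ?s = ?j" "(v + u ?j) mod Suc ?s = u ?j"
          using u by (simp_all only: eq div_mult_self3 mod_mult_self3) simp_all
        then have "cell ?w (v + u ?j) \<noteq> Bit False"
          by (simp add: cell_def block_word_def)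
        then show ?thesis using u by blast
      qed
    qed
  qed
  then show ?thesis
    using decides_init[of ?w l K] assms(1) by (simp add: run_free_def decides_def)
qed

lemma block_word_notin_run_free:
  assumes "l > 0" "i < m" "u i = Suc l ^ K" "m * Suc (Suc l ^ K) \<le> 2 ^ l"
  shows "block_word (2 ^ l) m (Suc l ^ K) u \<notin> run_free K"
proof -
  let ?s = "Suc l ^ K"
  let ?w = "block_word (2 ^ l) m ?s u"
  have "Suc i * Suc ?s \<le> m * Suc ?s" using assms(2) by (intro mult_right_mono) auto
  then have le: "i * Suc ?s + Suc ?s \<le> 2 ^ l" using assms(4) by simp
  have "cell ?w (i * Suc ?s + j) = Bit False" if "j < ?s" for j
  proof -
    have "(i * Suc ?s + j) div Suc ?s = i" "(i * Suc ?s + j) mod Suc ?s = j"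
      using that by (simp_all del: mult_Suc_right)
    then show ?thesis using le that assms(2,3) by (simp add: cell_def block_word_def)
  qed
  moreover have "i * Suc ?s < 2 ^ l" using le by simp
  ultimately show ?thesis
    using decides_init[of ?w l K] assms(1) by (auto simp: run_free_def decides_def)
qed

section \<open>Growth rates and the lower bound\<close>

lemma eventually_power_le_two_power: "\<forall>\<^sub>F l in sequentially. c * Suc l ^ q \<le> 2 ^ l"
proof -
  define a where "a = ln (2 :: real)"
  \<comment> \<open>At \<open>x = a * (l + 1)\<close> the exponential is \<open>2 ^ (l + 1)\<close>.
    This \<open>e\<close> cancels \<open>a ^ q\<close> and the extra factor 2; \<open>c + 1\<close>
    keeps the denominator positive for \<open>c = 0\<close>.\<close>
  define e where "e = a ^ q / (2 * (real c + 1))"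
  have a: "a > 0" by (simp add: a_def)
  then have "e > 0" by (simp add: e_def)
  with tendsto_power_div_exp_0[of q] have "\<forall>\<^sub>F x in at_top. x ^ q / exp x < e"
    by (rule order_tendstoD)
  moreover have "filterlim (\<lambda>l. a * real (Suc l)) at_top sequentially"
    using a filterlim_compose[OF filterlim_real_sequentially filterlim_Suc]
    by (intro filterlim_tendsto_pos_mult_at_top[OF tendsto_const])
  ultimately have "\<forall>\<^sub>F l in sequentially. (a * real (Suc l)) ^ q / exp (a * real (Suc l)) < e"
    by (rule eventually_compose_filterlim)
  then show ?thesis
  proof eventually_elim
    case (elim l)
    have "exp (a * real (Suc l)) = 2 ^ Suc l"
      unfolding a_def by (metis exp_ln exp_of_nat2_mult zero_less_numeral)
    with elim have "(a * real (Suc l)) ^ q / 2 ^ Suc l < a ^ q / (2 * (real c + 1))"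
      by (simp only: e_def)
    then have "(a * real (Suc l)) ^ q * (real c + 1) < a ^ q * 2 ^ l"
      by (simp add: field_simps)
    then have "a ^ q * ((real c + 1) * real (Suc l) ^ q) < a ^ q * 2 ^ l"
      by (simp only: power_mult_distrib ac_simps)
    then have "(real c + 1) * real (Suc l) ^ q < 2 ^ l"
      using a by simp
    moreover have "real c * real (Suc l) ^ q \<le> (real c + 1) * real (Suc l) ^ q"
      by (intro mult_right_mono) auto
    ultimately have "real c * real (Suc l) ^ q \<le> 2 ^ l" by linarith
    then have "real (c * Suc l ^ q) \<le> real (2 ^ l)" by simp
    then show ?case by (simp only: of_nat_le_iff)
  qed
qed

lemma run_free_notin_ATIME:
  "run_free (Suc k) \<notin> ATIME (\<lambda>n. log 2 (real n) ^ k) 2"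
proof
  assume "run_free (Suc k) \<in> ATIME (\<lambda>n. log 2 (real n) ^ k) 2"
  then obtain M t where M: "ratm M" "start M \<in> ex_states M"
    and t: "(\<lambda>n. real (t n)) \<in> O(\<lambda>n. log 2 (real n) ^ k)"
    and L: "run_free (Suc k) = {w. accepting M w (init M w)}"
    and within: "\<And>w. w \<in> run_free (Suc k) \<Longrightarrow> accepting_within M w (t (length w)) 2 (init M w)"
    unfolding ATIME_def by blast
  obtain c where c: "\<forall>\<^sub>F n in sequentially. norm (real (t n)) \<le> c * norm (log 2 (real n) ^ k)"
    using t by (auto elim: landau_o.bigE)
  define C where "C = nat \<lceil>c\<rceil>"
  define A where "A = card {a. action_ok M a} + 1"
  \<comment> \<open>Inputs of length \<open>2 ^ l\<close> suffice; their address tape has exactly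
    \<open>l\<close> cells.\<close>
  have "filterlim (\<lambda>l. 2 ^ l :: nat) sequentially sequentially"
    by (rule filterlim_subseq) (simp add: strict_mono_def)
  from eventually_compose_filterlim[OF c this]
  have "\<forall>\<^sub>F l in sequentially. real (t (2 ^ l)) \<le> c * real l ^ k"
    by (simp add: log_nat_power)
  moreover have "\<forall>\<^sub>F l in sequentially. A * (Suc l ^ Suc k * Suc (Suc l ^ Suc k)) \<le> 2 ^ l"
    using eventually_power_le_two_power[of "2 * A" "Suc k * 2"]
  proof eventually_elim
    case (elim l)
    have "1 \<le> Suc l ^ Suc k" by (rule one_le_power) simp
    then have "Suc (Suc l ^ Suc k) \<le> 2 * Suc l ^ Suc k" by linarith
    then have "A * (Suc l ^ Suc k * Suc (Suc l ^ Suc k)) \<le> A * (Suc l ^ Suc k * (2 * Suc l ^ Suc k))"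
      by (intro mult_left_mono) auto
    also have "\<dots> = 2 * A * Suc l ^ (Suc k * 2)"
      unfolding power_mult power2_eq_square by (simp only: ac_simps)
    finally show ?case using elim by (rule order_trans)
  qed
  ultimately have "\<forall>\<^sub>F l in sequentially. real (t (2 ^ l)) \<le> c * real l ^ k \<and>
      A * (Suc l ^ Suc k * Suc (Suc l ^ Suc k)) \<le> 2 ^ l \<and> l \<ge> 2 * C + 2"
    using eventually_ge_at_top[of "2 * C + 2"] by eventually_elim simp
  then obtain l where l: "real (t (2 ^ l)) \<le> c * real l ^ k"
      "A * (Suc l ^ Suc k * Suc (Suc l ^ Suc k)) \<le> 2 ^ l" "l \<ge> 2 * C + 2"
    unfolding eventually_sequentially by blast
  define T where "T = t (2 ^ l)"
  define s where "s = Suc l ^ Suc k"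
  \<comment> \<open>As \<open>A ^ T \<le> 2 ^ (A * T) < 2 ^ m\<close>, a factor 2 per block
    outweighs the number of guesses; that factor comes from
    \<open>2 * (T + 1) \<le> s\<close>.\<close>
  define m where "m = A * (T + 1)"
  have "c * real l ^ k \<le> real C * real l ^ k"
    by (intro mult_right_mono) (auto simp: C_def real_nat_ceiling_ge)
  with l(1) have "real T \<le> real (C * l ^ k)" by (simp add: T_def)
  then have T: "T \<le> C * l ^ k" by (simp only: of_nat_le_iff)
  have "1 \<le> l ^ k" using l(3) by simp
  \<comment> \<open>The extra factor \<open>Suc l\<close> that \<open>s\<close> has over
    \<open>Suc l ^ k\<close> beats the constant \<open>2 * C + 2\<close>.\<close>
  with T have "2 * (T + 1) \<le> (2 * C + 2) * l ^ k" by (simp add: algebra_simps)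
  also have "\<dots> \<le> Suc l * Suc l ^ k" using l(3) by (intro mult_mono power_mono) auto
  finally have s: "2 * (T + 1) \<le> s" by (simp add: s_def)
  have "A ^ T \<le> (2 ^ A) ^ T" by (intro power_mono) (auto intro: less_imp_le less_exp)
  also have "\<dots> = 2 ^ (A * T)" by (simp add: power_mult)
  also have "\<dots> < 2 ^ m" by (intro power_strict_increasing) (auto simp: m_def A_def)
  finally have "A ^ T * (T + 1) ^ m < 2 ^ m * (T + 1) ^ m" by simp
  also have "\<dots> = (2 * (T + 1)) ^ m" by (simp only: power_mult_distrib)
  also have "\<dots> \<le> s ^ m" using s by (intro power_mono) auto
  finally have count: "A ^ T * (T + 1) ^ m < s ^ m" .
  have "T + 1 \<le> s" using s by simp
  then have "m * Suc s \<le> A * s * Suc s" unfolding m_def by (intro mult_right_mono mult_left_mono) auto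
  also have "\<dots> \<le> 2 ^ l" using l(2) by (simp only: s_def mult.assoc)
  finally have fit: "m * Suc s \<le> 2 ^ l" .
  have "\<exists>u i. i < m \<and> u i = s \<and> accepting M (block_word (2 ^ l) m s u) (init M (block_word (2 ^ l) m s u))"
  proof (rule sigma2_fooled[OF M, of m s "2 ^ l" T])
    fix u assume "u \<in> {..<m} \<rightarrow>\<^sub>E {..<s}"
    then have "block_word (2 ^ l) m s u \<in> run_free (Suc k)"
      unfolding s_def using l(3) by (intro block_word_in_run_free) auto
    from within[OF this]
    show "accepting_within M (block_word (2 ^ l) m s u) T 2 (init M (block_word (2 ^ l) m s u))"
      by (simp add: T_def)
  qed (use count in \<open>simp add: A_def\<close>)
  then obtain u i where u: "i < m" "u i = s" "block_word (2 ^ l) m s u \<in> run_free (Suc k)"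
    using L by blast
  moreover have "block_word (2 ^ l) m s u \<notin> run_free (Suc k)"
    unfolding s_def using l(3) u(1,2) fit by (intro block_word_notin_run_free) (auto simp: s_def)
  ultimately show False by blast
qed

lemma ATIME_mono:
  assumes "f \<in> O(g)"
  shows "ATIME f m \<subseteq> ATIME g m"
  unfolding ATIME_def using landau_o.big_trans[OF _ assms] by blast

theorem theorem6:
  fixes k :: nat
  assumes "k > 1"
  shows "ATIME (\<lambda>n. log 2 (real n) ^ k) 2 \<subset> ATIME (\<lambda>n. log 2 (real n) ^ (k + 1)) 2"
proof -
  have "(\<lambda>n. log 2 (real n) ^ k) \<in> O(\<lambda>n. log 2 (real n) ^ (k + 1))"
  proof (rule bigoI)
    show "\<forall>\<^sub>F n in sequentially. norm (log 2 (real n) ^ k) \<le> 1 * norm (log 2 (real n) ^ (k + 1))"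
      using eventually_ge_at_top[of 2]
    proof eventually_elim
      case (elim n)
      then have "log 2 (real n) \<ge> 1" by (simp add: le_log_iff)
      then show ?case by (simp add: power_increasing)
    qed
  qed
  then have "ATIME (\<lambda>n. log 2 (real n) ^ k) 2 \<subseteq> ATIME (\<lambda>n. log 2 (real n) ^ (k + 1)) 2"
    by (rule ATIME_mono)
  moreover have "run_free (k + 1) \<in> ATIME (\<lambda>n. log 2 (real n) ^ (k + 1)) 2"
    by (rule run_free_in_ATIME) simp
  moreover have "run_free (k + 1) \<notin> ATIME (\<lambda>n. log 2 (real n) ^ k) 2"
    using run_free_notin_ATIME[of k] by simp
  ultimately show ?thesis by blast
qed

end
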